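(* Let $\mathcal{H}$ be a complex Hilbert space and let $T\in\mathcal{B}(\mathcal{H})$ have closed range. Then the following are equivalent: (1) $T$ is EP. (2) There exist Hilbert spaces $\mathcal{K}_1$ and $\mathcal{L}_1$, a unitary $U_1\in\mathcal{B}(\mathcal{K}_1\oplus\mathcal{L}_1,\mathcal{H})$ and an isomorphism $A_1\in\mathcal{B}(\mathcal{K}_1)$ such that $T^*T=U_1(A_1^*A_1\oplus 0)U_1^*$ and $TT^*=U_1(A_1A_1^*\oplus 0)U_1^*$. (3) Both of the following conditions (a) and (b) hold: (a) There exist Hilbert spaces $\mathcal{K}_2$ and $\mathcal{L}_2$, an injective $V_2\in\mathcal{B}(\mathcal{K}_2\oplus\mathcal{L}_2,\mathcal{H})$, $W_2\in\mathcal{B}(\mathcal{K}_2\oplus\mathcal{L}_2,\mathcal{H})$, $S_2\in\mathcal{B}(\mathcal{H},\mathcal{K}_2\oplus\mathcal{L}_2)$, an injective $A_2\in\mathcal{B}(\mathcal{K}_2)$ and $B_2\in\mathcal{B}(\mathcal{K}_2)$ such that $T^*T=V_2(A_2\oplus 0)S_2$ and $TT^*=W_2(B_2\oplus 0)S_2$. (b) There exist Hilbert spaces $\mathcal{K}_3$ and $\mathcal{L}_3$, $V_3\in\mathcal{B}(\mathcal{K}_3\oplus\mathcal{L}_3,\mathcal{H})$, an injective $W_3\in\mathcal{B}(\mathcal{K}_3\oplus\mathcal{L}_3,\mathcal{H})$, $S_3\in\mathcal{B}(\mathcal{H},\mathcal{K}_3\oplus\mathcal{L}_3)$, $A_3\in\mathcal{B}(\mathcal{K}_3)$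 and an injective $B_3\in\mathcal{B}(\mathcal{K}_3)$ such that $T^*T=V_3(A_3\oplus 0)S_3$ and $TT^*=W_3(B_3\oplus 0)S_3$. (4) There exist Hilbert spaces $\mathcal{K}_4$ and $\mathcal{L}_4$, an isomorphism $U_4\in\mathcal{B}(\mathcal{K}_4\oplus\mathcal{L}_4,\mathcal{H})$ and $A_4,B_4\in\mathcal{B}(\mathcal{K}_4)$, both injective with closed range, such that $T^*T=U_4(A_4\oplus 0)U_4^{-1}$ and $TT^*=U_4(B_4\oplus 0)U_4^{-1}$.
   Context: All Hilbert spaces are complex. $\mathcal{B}(\mathcal{H},\mathcal{K})$ denotes the bounded linear operators from $\mathcal{H}$ to $\mathcal{K}$, and $\mathcal{B}(\mathcal{H})=\mathcal{B}(\mathcal{H},\mathcal{H})$. $\mathcal{N}(T)$ is the kernel of $T$ and $T^*$ its adjoint. An operator $T\in\mathcal{B}(\mathcal{H})$ with closed range is called EP if $\mathcal{N}(T)=\mathcal{N}(T^* )$. A bounded operator $U\in\mathcal{B}(\mathcal{H},\mathcal{K})$ is an isomorphism if it is injective and onto (not necessarily isometric), and is unitary if $U^*U=I$ and $UU^*=I$. $\mathcal{K}\oplus\mathcal{L}$ is the exterior Hilbert space ($2$-)direct sum, and for $A\in\mathcal{B}(\mathcal{K})$ and $S\in\mathcal{B}(\mathcal{L})$, $A\oplus S$ is the direct sum operator $(y,z)\mapsto(Ay,Sz)$ on $\mathcal{K}\oplus\mathcal{L}$; in $A\oplus 0$ the $0$ is the zero operator on the second summand. *)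

theory Defs
  imports "HOL-Analysis.Analysis" "HOL-Algebra.Module" "HOL-Algebra.AbelCoset"
begin

text \<open>
  Hilbert spaces are structures with an explicit carrier, so that their existence can be asserted
  inside a formula. The fields \<open>mult\<close> and \<open>one\<close> inherited from the ring record are unused,
  as for every module over this record type.
\<close>

definition complex_ring :: "complex ring" where
  "complex_ring = \<lparr>carrier = UNIV, mult = (*), one = 1, zero = 0, add = (+)\<rparr>"

record 'a hilbert = "(complex, 'a) module" +
  cinner :: "'a \<Rightarrow> 'a \<Rightarrow> complex"

definition hnorm :: "'a hilbert \<Rightarrow> 'a \<Rightarrow> real" where
  "hnorm H x = sqrt (Re (cinner H x x))"

text \<open>The locale \<open>Metric_space\<close> requires symmetry and nonnegativity off the carrier as well.\<close>

definition hdist :: "'a hilbert \<Rightarrow> 'a \<Rightarrow> 'a \<Rightarrow> real" where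
  "hdist H x y =
    (if x \<in> carrier H \<and> y \<in> carrier H then hnorm H (x \<ominus>\<^bsub>H\<^esub> y) else 0)"

locale complex_inner_space = Module.module complex_ring H for H :: "'a hilbert" (structure) +
  assumes cinner_commute:
      "\<lbrakk>x \<in> carrier H; y \<in> carrier H\<rbrakk> \<Longrightarrow> cinner H y x = cnj (cinner H x y)"
    and cinner_add_left:
      "\<lbrakk>x \<in> carrier H; y \<in> carrier H; z \<in> carrier H\<rbrakk>
        \<Longrightarrow> cinner H (x \<oplus> y) z = cinner H x z + cinner H y z"
    and cinner_smult_left:
      "\<lbrakk>x \<in> carrier H; y \<in> carrier H\<rbrakk> \<Longrightarrow> cinner H (c \<odot> x) y = c * cinner H x y"
    and cinner_pos:
      "\<lbrakk>x \<in> carrier H; x \<noteq> \<zero>\<rbrakk> \<Longrightarrow> 0 < Re (cinner H x x)"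

locale hilbert_space = complex_inner_space +
  assumes complete: "Metric_space.mcomplete (carrier H) (hdist H)"

definition hsum :: "'a hilbert \<Rightarrow> 'b hilbert \<Rightarrow> ('a \<times> 'b) hilbert" where
  "hsum K L =
    \<lparr>carrier = carrier K \<times> carrier L,
     mult = undefined, one = undefined,
     zero = (\<zero>\<^bsub>K\<^esub>, \<zero>\<^bsub>L\<^esub>),
     add = (\<lambda>(y, z) (y', z'). (y \<oplus>\<^bsub>K\<^esub> y', z \<oplus>\<^bsub>L\<^esub> z')),
     smult = (\<lambda>c (y, z). (c \<odot>\<^bsub>K\<^esub> y, c \<odot>\<^bsub>L\<^esub> z)),
     cinner = (\<lambda>(y, z) (y', z'). cinner K y y' + cinner L z z')\<rparr>"

text \<open>
  Operators are ordinary functions of which only the values on the carrier matter; accordingly,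
  equations between operators are stated pointwise on the carrier.
\<close>

definition bounded_ops :: "'a hilbert \<Rightarrow> 'b hilbert \<Rightarrow> ('a \<Rightarrow> 'b) set" where
  "bounded_ops H K = {T. T \<in> carrier H \<rightarrow> carrier K \<and>
    (\<forall>x \<in> carrier H. \<forall>y \<in> carrier H. T (x \<oplus>\<^bsub>H\<^esub> y) = T x \<oplus>\<^bsub>K\<^esub> T y) \<and>
    (\<forall>c. \<forall>x \<in> carrier H. T (c \<odot>\<^bsub>H\<^esub> x) = c \<odot>\<^bsub>K\<^esub> T x) \<and>
    (\<exists>b. \<forall>x \<in> carrier H. hnorm K (T x) \<le> b * hnorm H x)}"

text \<open>
  For bounded \<open>T\<close> between Hilbert spaces and \<open>y\<close> in the carrier of \<open>K\<close>, the vector below exists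
  and is unique by the Riesz representation theorem.
\<close>

definition adjoint :: "'a hilbert \<Rightarrow> 'b hilbert \<Rightarrow> ('a \<Rightarrow> 'b) \<Rightarrow> 'b \<Rightarrow> 'a" where
  "adjoint H K T y =
    (THE x. x \<in> carrier H \<and> (\<forall>z \<in> carrier H. cinner K (T z) y = cinner H z x))"

definition closed_range :: "'a hilbert \<Rightarrow> 'b hilbert \<Rightarrow> ('a \<Rightarrow> 'b) \<Rightarrow> bool" where
  "closed_range H K T \<longleftrightarrow>
    closedin (Metric_space.mtopology (carrier K) (hdist K)) (T ` carrier H)"

definition EP :: "'a hilbert \<Rightarrow> ('a \<Rightarrow> 'a) \<Rightarrow> bool" where
  "EP H T \<longleftrightarrow> T \<in> bounded_ops H H \<and> closed_range H H T \<and>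
    a_kernel H H T = a_kernel H H (adjoint H H T)"

definition isomorphism :: "'a hilbert \<Rightarrow> 'b hilbert \<Rightarrow> ('a \<Rightarrow> 'b) \<Rightarrow> bool" where
  "isomorphism H K U \<longleftrightarrow> U \<in> bounded_ops H K \<and> bij_betw U (carrier H) (carrier K)"

definition unitary :: "'a hilbert \<Rightarrow> 'b hilbert \<Rightarrow> ('a \<Rightarrow> 'b) \<Rightarrow> bool" where
  "unitary H K U \<longleftrightarrow> U \<in> bounded_ops H K \<and>
    (\<forall>x \<in> carrier H. adjoint H K U (U x) = x) \<and>
    (\<forall>y \<in> carrier K. U (adjoint H K U y) = y)"

text \<open>\<open>oplus_zero L A\<close> is the operator \<open>A \<oplus> 0\<close>, where \<open>0\<close> acts on \<open>L\<close>.\<close>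

definition oplus_zero :: "'b hilbert \<Rightarrow> ('a \<Rightarrow> 'a) \<Rightarrow> 'a \<times> 'b \<Rightarrow> 'a \<times> 'b" where
  "oplus_zero L A = map_prod A (\<lambda>_. \<zero>\<^bsub>L\<^esub>)"

definition unitary_form ::
  "'h hilbert \<Rightarrow> ('h \<Rightarrow> 'h) \<Rightarrow> 'k hilbert \<Rightarrow> 'l hilbert \<Rightarrow> bool" where
  "unitary_form H T K L \<longleftrightarrow>
    (\<exists>U A. unitary (hsum K L) H U \<and> isomorphism K K A \<and>
      (\<forall>x \<in> carrier H. adjoint H H T (T x) =
        U (oplus_zero L (adjoint K K A \<circ> A) (adjoint (hsum K L) H U x))) \<and>
      (\<forall>x \<in> carrier H. T (adjoint H H T x) =
        U (oplus_zero L (A \<circ> adjoint K K A) (adjoint (hsum K L) H U x))))"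

definition left_injective_form ::
  "'h hilbert \<Rightarrow> ('h \<Rightarrow> 'h) \<Rightarrow> 'k hilbert \<Rightarrow> 'l hilbert \<Rightarrow> bool" where
  "left_injective_form H T K L \<longleftrightarrow>
    (\<exists>V \<in> bounded_ops (hsum K L) H. \<exists>W \<in> bounded_ops (hsum K L) H.
     \<exists>S \<in> bounded_ops H (hsum K L). \<exists>A \<in> bounded_ops K K. \<exists>B \<in> bounded_ops K K.
      inj_on V (carrier (hsum K L)) \<and> inj_on A (carrier K) \<and>
      (\<forall>x \<in> carrier H. adjoint H H T (T x) = V (oplus_zero L A (S x))) \<and>
      (\<forall>x \<in> carrier H. T (adjoint H H T x) = W (oplus_zero L B (S x))))"

definition right_injective_form ::
  "'h hilbert \<Rightarrow> ('h \<Rightarrow> 'h) \<Rightarrow> 'k hilbert \<Rightarrow> 'l hilbert \<Rightarrow> bool" where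
  "right_injective_form H T K L \<longleftrightarrow>
    (\<exists>V \<in> bounded_ops (hsum K L) H. \<exists>W \<in> bounded_ops (hsum K L) H.
     \<exists>S \<in> bounded_ops H (hsum K L). \<exists>A \<in> bounded_ops K K. \<exists>B \<in> bounded_ops K K.
      inj_on W (carrier (hsum K L)) \<and> inj_on B (carrier K) \<and>
      (\<forall>x \<in> carrier H. adjoint H H T (T x) = V (oplus_zero L A (S x))) \<and>
      (\<forall>x \<in> carrier H. T (adjoint H H T x) = W (oplus_zero L B (S x))))"

definition similarity_form ::
  "'h hilbert \<Rightarrow> ('h \<Rightarrow> 'h) \<Rightarrow> 'k hilbert \<Rightarrow> 'l hilbert \<Rightarrow> bool" where
  "similarity_form H T K L \<longleftrightarrow>
    (\<exists>U. isomorphism (hsum K L) H U \<and>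
    (\<exists>A \<in> bounded_ops K K. \<exists>B \<in> bounded_ops K K.
      inj_on A (carrier K) \<and> closed_range K K A \<and>
      inj_on B (carrier K) \<and> closed_range K K B \<and>
      (\<forall>x \<in> carrier H. adjoint H H T (T x) =
        U (oplus_zero L A (inv_into (carrier (hsum K L)) U x))) \<and>
      (\<forall>x \<in> carrier H. T (adjoint H H T x) =
        U (oplus_zero L B (inv_into (carrier (hsum K L)) U x)))))"

end

theory Submission
  imports Defs
begin

text \<open>
  Each of the three conditions describes the kernels of \<open>T\<^sup>*T\<close> and \<open>TT\<^sup>*\<close>, which are the kernels of
  \<open>T\<close> and \<open>T\<^sup>*\<close>. Suppose that \<open>T\<^sup>*T = V(A \<oplus> 0)S\<close> and \<open>TT\<^sup>* = W(B \<oplus> 0)S\<close>. The vectors \<open>x\<close> such that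
  \<open>Sx\<close> has first component \<open>0\<close> lie in both kernels; they are the whole kernel of \<open>T\<close> if \<open>V\<close> and \<open>A\<close>
  are injective, and the whole kernel of \<open>T\<^sup>*\<close> if \<open>W\<close> and \<open>B\<close> are. Hence a factorization with \<open>V\<close> and
  \<open>A\<close> injective gives \<open>N(T) \<subseteq> N(T\<^sup>*)\<close>, one with \<open>W\<close> and \<open>B\<close> injective gives the other inclusion, and
  a similarity gives both (\<open>left_injective_form_kernel\<close>, \<open>right_injective_form_kernel\<close>,
  \<open>similarity_form_kernel\<close>).

  Conversely, let \<open>T\<close> be EP. Then \<open>N(T) = N(T\<^sup>*)\<close> is the orthogonal complement of the closed subspace
  \<open>R(T)\<close>, so that \<open>U(y, z) = y + z\<close> is a unitary from \<open>R(T) \<oplus> N(T)\<close> to the whole space. The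
  restriction \<open>A\<close> of \<open>T\<close> to \<open>R(T)\<close> is a bounded bijection of \<open>R(T)\<close> whose adjoint is the restriction
  of \<open>T\<^sup>*\<close>, which gives the unitary form (\<open>EP_imp_unitary_form\<close>).

  The unitary form is a special case of all the others, with blocks \<open>A\<^sup>*A\<close> and \<open>AA\<^sup>*\<close>
  (\<open>unitary_form_imp_forms\<close>). What has to be proved is that these blocks are injective with closed
  range. Both follow from lower bounds \<open>c\<parallel>x\<parallel> \<le> \<parallel>Ax\<parallel>\<close> and \<open>c\<parallel>x\<parallel> \<le> \<parallel>A\<^sup>*x\<parallel>\<close>, which hold for every bounded
  bijection by the uniform boundedness principle (\<open>isomorphism_bounded_below\<close>).

  Adjoints and projections rest on the Riesz representation theorem, proved here for Hilbert spaces
  with an explicit carrier.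
\<close>

section \<open>Algebra and metric of inner product spaces\<close>

lemma complex_ring_simps [simp]:
  "carrier complex_ring = UNIV" "\<zero>\<^bsub>complex_ring\<^esub> = 0" "\<one>\<^bsub>complex_ring\<^esub> = 1"
  "x \<oplus>\<^bsub>complex_ring\<^esub> y = x + y" "x \<otimes>\<^bsub>complex_ring\<^esub> y = x * y"
  by (simp_all add: complex_ring_def)

context complex_inner_space
begin

lemma cinner_add_right:
  "\<lbrakk>x \<in> carrier H; y \<in> carrier H; z \<in> carrier H\<rbrakk>
    \<Longrightarrow> cinner H z (x \<oplus> y) = cinner H z x + cinner H z y"
  using cinner_commute[of "x \<oplus> y" z] cinner_commute[of x z] cinner_commute[of y z]
  by (simp add: cinner_add_left)

lemma scale_closed [simp]: "x \<in> carrier H \<Longrightarrow> c \<odot> x \<in> carrier H"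
  by simp

lemma cinner_smult_right:
  "\<lbrakk>x \<in> carrier H; y \<in> carrier H\<rbrakk> \<Longrightarrow> cinner H y (c \<odot> x) = cnj c * cinner H y x"
  using cinner_commute[of "c \<odot> x" y] cinner_commute[of x y]
  by (simp add: cinner_smult_left)

lemma cinner_zero_left [simp]: "y \<in> carrier H \<Longrightarrow> cinner H \<zero> y = 0"
  using cinner_smult_left[of y y 0] smult_l_null[of y] by simp

lemma cinner_zero_right [simp]: "y \<in> carrier H \<Longrightarrow> cinner H y \<zero> = 0"
  using cinner_commute[of \<zero> y] by simp

lemma cinner_minus_left:
  assumes "x \<in> carrier H" "y \<in> carrier H"
  shows "cinner H (\<ominus> x) y = - cinner H x y"
  using cinner_add_left[of x "\<ominus> x" y] assms by (simp add: M.r_neg eq_neg_iff_add_eq_0 add.commute)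

lemma cinner_minus_right:
  assumes "x \<in> carrier H" "y \<in> carrier H"
  shows "cinner H y (\<ominus> x) = - cinner H y x"
  using cinner_add_right[of x "\<ominus> x" y] assms by (simp add: M.r_neg eq_neg_iff_add_eq_0 add.commute)

lemmas cinner_simps = cinner_add_left cinner_add_right cinner_smult_left cinner_smult_right
  cinner_minus_left cinner_minus_right a_minus_def

lemma diff_closed [simp]: "\<lbrakk>x \<in> carrier H; y \<in> carrier H\<rbrakk> \<Longrightarrow> x \<ominus> y \<in> carrier H"
  by (rule M.minus_closed)

lemma cinner_self_eq_0: "x \<in> carrier H \<Longrightarrow> cinner H x x = 0 \<longleftrightarrow> x = \<zero>"
  by (metis cinner_pos cinner_zero_left less_irrefl zero_complex.simps(1))

lemma diff_eq_0: "\<lbrakk>x \<in> carrier H; y \<in> carrier H\<rbrakk> \<Longrightarrow> x \<ominus> y = \<zero> \<longleftrightarrow> x = y"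
  by (metis M.a_inv_closed M.minus_equality M.minus_minus M.r_neg a_minus_def)

text \<open>
  Vectors are determined by their inner products. Identities between vectors are proved through this
  rule below, since it reduces them to identities between complex numbers.
\<close>

lemma cinner_eqI:
  assumes "x \<in> carrier H" "y \<in> carrier H"
    and "\<And>z. z \<in> carrier H \<Longrightarrow> cinner H z x = cinner H z y"
  shows "x = y"
proof -
  have "cinner H (x \<ominus> y) (x \<ominus> y) = 0"
    using assms(3)[of "x \<ominus> y"] assms(1,2) by (simp add: cinner_simps)
  then show ?thesis
    using assms(1,2) by (simp add: cinner_self_eq_0 diff_eq_0)
qed

lemma hnorm_nonneg [simp]: "x \<in> carrier H \<Longrightarrow> 0 \<le> hnorm H x"
  using cinner_pos[of x] by (cases "x = \<zero>") (auto simp: hnorm_def)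

lemma hnorm_sq: "x \<in> carrier H \<Longrightarrow> (hnorm H x)\<^sup>2 = Re (cinner H x x)"
  using cinner_pos[of x] by (cases "x = \<zero>") (auto simp: hnorm_def)

lemma cinner_self: "x \<in> carrier H \<Longrightarrow> cinner H x x = of_real ((hnorm H x)\<^sup>2)"
  using cinner_commute[of x x] by (simp add: hnorm_sq complex_eq_iff)

lemma hnorm_zero [simp]: "hnorm H \<zero> = 0"
  by (simp add: hnorm_def)

lemma hnorm_eq_0: "x \<in> carrier H \<Longrightarrow> hnorm H x = 0 \<longleftrightarrow> x = \<zero>"
  using cinner_self[of x] cinner_self_eq_0[of x] by auto

lemma hnorm_smult: "x \<in> carrier H \<Longrightarrow> hnorm H (c \<odot> x) = cmod c * hnorm H x"
proof -
  assume x: "x \<in> carrier H"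
  have "cinner H (c \<odot> x) (c \<odot> x) = of_real ((cmod c * hnorm H x)\<^sup>2)"
    using x by (simp add: cinner_simps cinner_self[OF x] power_mult_distrib complex_norm_square[of c]
        del: of_real_power)
  then show ?thesis
    using x by (simp add: hnorm_def[of H "c \<odot> x"])
qed

lemma Cauchy_Schwarz:
  assumes x: "x \<in> carrier H" and y: "y \<in> carrier H"
  shows "cmod (cinner H x y) \<le> hnorm H x * hnorm H y"
proof (cases "y = \<zero>")
  case False
  let ?a = "of_real ((hnorm H y)\<^sup>2) :: complex" and ?c = "cinner H x y"
  \<comment> \<open>A positive multiple of the component of \<open>x\<close> orthogonal to \<open>y\<close>.\<close>
  let ?z = "?a \<odot> x \<ominus> ?c \<odot> y"
  have "cinner H ?z ?z = of_real ((hnorm H y)\<^sup>2 * ((hnorm H y)\<^sup>2 * (hnorm H x)\<^sup>2 - (cmod ?c)\<^sup>2))"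
    using x y cinner_commute[OF x y] complex_norm_square[of ?c]
    by (simp add: cinner_simps cinner_self[OF x] cinner_self[OF y]
        algebra_simps power2_eq_square del: of_real_power)
  then have "0 \<le> (hnorm H y)\<^sup>2 * ((hnorm H y)\<^sup>2 * (hnorm H x)\<^sup>2 - (cmod ?c)\<^sup>2)"
    using hnorm_sq[of ?z] x y zero_le_power2[of "hnorm H ?z"]
    by (simp del: zero_le_power2)
  moreover have "0 < (hnorm H y)\<^sup>2"
    using False hnorm_eq_0[OF y] by simp
  ultimately have "0 \<le> (hnorm H y)\<^sup>2 * (hnorm H x)\<^sup>2 - (cmod ?c)\<^sup>2"
    by (metis linorder_not_le mult_pos_neg)
  then have "(cmod ?c)\<^sup>2 \<le> (hnorm H x * hnorm H y)\<^sup>2"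
    by (simp add: power_mult_distrib mult.commute)
  then show ?thesis
    using x y by (auto intro: power2_le_imp_le)
qed (use x in simp)

lemma hnorm_add_sq:
  "\<lbrakk>x \<in> carrier H; y \<in> carrier H\<rbrakk> \<Longrightarrow>
    (hnorm H (x \<oplus> y))\<^sup>2 = (hnorm H x)\<^sup>2 + 2 * Re (cinner H x y) + (hnorm H y)\<^sup>2"
  using cinner_commute[of x y] by (simp add: hnorm_sq cinner_simps)

lemma hnorm_minus: "x \<in> carrier H \<Longrightarrow> hnorm H (\<ominus> x) = hnorm H x"
  by (simp add: hnorm_def cinner_simps)

lemma hnorm_triangle:
  assumes x: "x \<in> carrier H" and y: "y \<in> carrier H"
  shows "hnorm H (x \<oplus> y) \<le> hnorm H x + hnorm H y"
proof -
  have "Re (cinner H x y) \<le> hnorm H x * hnorm H y"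
    using Cauchy_Schwarz[OF x y] complex_Re_le_cmod order_trans by blast
  then have "(hnorm H (x \<oplus> y))\<^sup>2 \<le> (hnorm H x + hnorm H y)\<^sup>2"
    using x y by (simp add: hnorm_add_sq power2_sum)
  then show ?thesis
    using x y by (auto intro: power2_le_imp_le)
qed

lemma hnorm_diff_commute:
  assumes x: "x \<in> carrier H" and y: "y \<in> carrier H"
  shows "hnorm H (x \<ominus> y) = hnorm H (y \<ominus> x)"
  using x y by (simp add: hnorm_def cinner_simps)

lemma diff_add_diff: 
  assumes "x \<in> carrier H" "y \<in> carrier H" "z \<in> carrier H"
  shows "(x \<ominus> y) \<oplus> (y \<ominus> z) = x \<ominus> z"
  using assms by (intro cinner_eqI) (simp_all add: cinner_simps)

lemma hnorm_diff_triangle: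
  assumes "x \<in> carrier H" "y \<in> carrier H" "z \<in> carrier H"
  shows "hnorm H (x \<ominus> z) \<le> hnorm H (x \<ominus> y) + hnorm H (y \<ominus> z)"
  using hnorm_triangle[of "x \<ominus> y" "y \<ominus> z"] assms by (simp add: diff_add_diff)

sublocale metric: Metric_space "carrier H" "hdist H"
proof
  fix x y z
  show "0 \<le> hdist H x y" "hdist H x y = hdist H y x"
    by (simp_all add: hdist_def hnorm_diff_commute)
  show "hdist H x y = 0 \<longleftrightarrow> x = y" if "x \<in> carrier H" "y \<in> carrier H"
    using that by (simp add: hdist_def hnorm_eq_0 diff_eq_0)
  show "hdist H x z \<le> hdist H x y + hdist H y z"
    if "x \<in> carrier H" "y \<in> carrier H" "z \<in> carrier H"
    using that by (simp add: hdist_def hnorm_diff_triangle)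
qed

end

section \<open>Convergence and the Riesz representation theorem\<close>

context complex_inner_space
begin

lemma limitin_iff:
  assumes "\<And>n. \<sigma> n \<in> carrier H" "l \<in> carrier H"
  shows "limitin metric.mtopology \<sigma> l sequentially \<longleftrightarrow> (\<lambda>n. hnorm H (\<sigma> n \<ominus> l)) \<longlonglongrightarrow> 0"
  using assms by (simp add: metric.limitin_metric_dist_null hdist_def)

lemma MCauchy_iff:
  "metric.MCauchy \<sigma> \<longleftrightarrow> (\<forall>n. \<sigma> n \<in> carrier H) \<and>
    (\<forall>e>0. \<exists>N. \<forall>m\<ge>N. \<forall>n\<ge>N. hnorm H (\<sigma> m \<ominus> \<sigma> n) < e)"
proof (cases "\<forall>n. \<sigma> n \<in> carrier H")
  case True
  then have "hdist H (\<sigma> m) (\<sigma> n) = hnorm H (\<sigma> m \<ominus> \<sigma> n)" for m n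
    by (simp add: hdist_def)
  with True show ?thesis
    by (auto simp: metric.MCauchy_def)
qed (auto simp: metric.MCauchy_def)

lemma mcomplete_iff:
  "metric.mcomplete \<longleftrightarrow>
    (\<forall>\<sigma>. (\<forall>n. \<sigma> n \<in> carrier H) \<and> (\<forall>e>0. \<exists>N. \<forall>m\<ge>N. \<forall>n\<ge>N. hnorm H (\<sigma> m \<ominus> \<sigma> n) < e)
      \<longrightarrow> (\<exists>l\<in>carrier H. (\<lambda>n. hnorm H (\<sigma> n \<ominus> l)) \<longlonglongrightarrow> 0))"
proof -
  have "(\<exists>l. limitin metric.mtopology \<sigma> l sequentially) \<longleftrightarrow>
      (\<exists>l\<in>carrier H. (\<lambda>n. hnorm H (\<sigma> n \<ominus> l)) \<longlonglongrightarrow> 0)"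
    if "\<forall>n. \<sigma> n \<in> carrier H" for \<sigma>
    using limitin_iff[of \<sigma>] metric.limitin_mspace[of \<sigma> _ sequentially] that by blast
  then show ?thesis
    unfolding metric.mcomplete_def MCauchy_iff by auto
qed

lemma hlim_unique:
  assumes "\<And>n. \<sigma> n \<in> carrier H" "l \<in> carrier H" "l' \<in> carrier H"
    and "(\<lambda>n. hnorm H (\<sigma> n \<ominus> l)) \<longlonglongrightarrow> 0" "(\<lambda>n. hnorm H (\<sigma> n \<ominus> l')) \<longlonglongrightarrow> 0"
  shows "l = l'"
  using assms by (metis limitin_iff metric.limitin_metric_unique sequentially_bot)

lemma minus_eq_smult: "x \<in> carrier H \<Longrightarrow> \<ominus> x = (-1) \<odot> x"
  by (intro cinner_eqI) (simp_all add: cinner_simps)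

lemma closedin_iff:
  "closedin metric.mtopology S \<longleftrightarrow> S \<subseteq> carrier H \<and>
    (\<forall>\<sigma> l. (\<forall>n. \<sigma> n \<in> S) \<and> l \<in> carrier H \<and> (\<lambda>n. hnorm H (\<sigma> n \<ominus> l)) \<longlonglongrightarrow> 0 \<longrightarrow> l \<in> S)"
proof (cases "S \<subseteq> carrier H")
  case True
  have "range \<sigma> \<subseteq> S \<and> limitin metric.mtopology \<sigma> l sequentially \<longleftrightarrow>
      (\<forall>n. \<sigma> n \<in> S) \<and> l \<in> carrier H \<and> (\<lambda>n. hnorm H (\<sigma> n \<ominus> l)) \<longlonglongrightarrow> 0" for \<sigma> l
    using limitin_iff[of \<sigma> l] metric.limitin_mspace[of \<sigma> l sequentially] True by blast
  with True show ?thesis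
    by (simp add: metric.metric_closedin_iff_sequentially_closed)
qed (simp add: metric.metric_closedin_iff_sequentially_closed)

lemma hnorm_diff_ge:
  assumes x: "x \<in> carrier H" and y: "y \<in> carrier H"
  shows "\<bar>hnorm H x - hnorm H y\<bar> \<le> hnorm H (x \<ominus> y)"
proof -
  have "hnorm H u \<le> hnorm H (u \<ominus> v) + hnorm H v"
    if "u \<in> carrier H" "v \<in> carrier H" for u v
  proof -
    have "u = (u \<ominus> v) \<oplus> v"
      using that by (intro cinner_eqI) (simp_all add: cinner_simps)
    then show ?thesis
      using hnorm_triangle[of "u \<ominus> v" v] that by simp
  qed
  from this[OF x y] this[OF y x] show ?thesis
    by (simp add: hnorm_diff_commute[OF x y])
qed

lemma tendsto_hnorm:
  assumes "\<And>n. \<sigma> n \<in> carrier H" "l \<in> carrier H" "(\<lambda>n. hnorm H (\<sigma> n \<ominus> l)) \<longlonglongrightarrow> 0"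
  shows "(\<lambda>n. hnorm H (\<sigma> n)) \<longlonglongrightarrow> hnorm H l"
  using Lim_null_comparison[OF _ assms(3), of "\<lambda>n. hnorm H (\<sigma> n) - hnorm H l"] assms(1,2)
  by (simp add: hnorm_diff_ge LIM_zero_cancel)

lemma tendsto_bounded_additive:
  fixes f :: "'a \<Rightarrow> complex"
  assumes "\<And>n. \<sigma> n \<in> carrier H" "l \<in> carrier H" "(\<lambda>n. hnorm H (\<sigma> n \<ominus> l)) \<longlonglongrightarrow> 0"
    and add: "\<And>x y. \<lbrakk>x \<in> carrier H; y \<in> carrier H\<rbrakk> \<Longrightarrow> f (x \<oplus> y) = f x + f y"
    and bound: "\<And>x. x \<in> carrier H \<Longrightarrow> cmod (f x) \<le> b * hnorm H x"
  shows "(\<lambda>n. f (\<sigma> n)) \<longlonglongrightarrow> f l"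
proof -
  have "cmod (f (\<sigma> n) - f l) \<le> b * hnorm H (\<sigma> n \<ominus> l)" for n
  proof -
    have "\<sigma> n = (\<sigma> n \<ominus> l) \<oplus> l"
      using assms(1,2) by (intro cinner_eqI) (simp_all add: cinner_simps)
    then have "f (\<sigma> n) - f l = f (\<sigma> n \<ominus> l)"
      using add[of "\<sigma> n \<ominus> l" l] assms(1,2) by simp
    then show ?thesis
      using bound assms(1,2) by simp
  qed
  then have "\<forall>\<^sub>F n in sequentially. cmod (f (\<sigma> n) - f l) \<le> b * hnorm H (\<sigma> n \<ominus> l)"
    by simp
  moreover have "(\<lambda>n. b * hnorm H (\<sigma> n \<ominus> l)) \<longlonglongrightarrow> 0"
    using tendsto_mult_left[OF assms(3), of b] by simp
  ultimately have "(\<lambda>n. f (\<sigma> n) - f l) \<longlonglongrightarrow> 0"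
    by (rule Lim_null_comparison)
  then show ?thesis
    by (rule LIM_zero_cancel)
qed

lemma tendsto_cinner_left:
  assumes "\<And>n. \<sigma> n \<in> carrier H" "l \<in> carrier H" "(\<lambda>n. hnorm H (\<sigma> n \<ominus> l)) \<longlonglongrightarrow> 0"
    and "z \<in> carrier H"
  shows "(\<lambda>n. cinner H (\<sigma> n) z) \<longlonglongrightarrow> cinner H l z"
  using assms Cauchy_Schwarz[of _ z]
  by (intro tendsto_bounded_additive[where b = "hnorm H z"])
    (simp_all add: cinner_simps mult.commute)

end

text \<open>
  The representing vector is found as the minimizer \<open>z\<close> of \<open>J x = \<parallel>x\<parallel>\<^sup>2 - 2 Re (f x)\<close>. Minimizing
  sequences are Cauchy by the parallelogram law, and the first variation of \<open>J\<close> at \<open>z\<close> in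
  the direction \<open>x\<close> is \<open>2 Re (\<langle>x, z\<rangle> - f x)\<close>.
\<close>

theorem (in hilbert_space) Riesz_representation:
  fixes f :: "'a \<Rightarrow> complex"
  assumes add: "\<And>x y. \<lbrakk>x \<in> carrier H; y \<in> carrier H\<rbrakk> \<Longrightarrow> f (x \<oplus> y) = f x + f y"
    and scale: "\<And>c x. x \<in> carrier H \<Longrightarrow> f (c \<odot> x) = c * f x"
    and bound: "\<And>x. x \<in> carrier H \<Longrightarrow> cmod (f x) \<le> b * hnorm H x"
  shows "\<exists>z\<in>carrier H. \<forall>x\<in>carrier H. f x = cinner H x z"
proof -
  define J where "J x = (hnorm H x)\<^sup>2 - 2 * Re (f x)" for x
  define d where "d = Inf (J ` carrier H)"
  \<comment> \<open>Completing the square.\<close>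
  have J_lower: "- b\<^sup>2 \<le> J x" if x: "x \<in> carrier H" for x
  proof -
    have "Re (f x) \<le> b * hnorm H x"
      using bound[OF x] complex_Re_le_cmod order_trans by blast
    moreover have "0 \<le> (hnorm H x - b)\<^sup>2"
      by simp
    ultimately show ?thesis
      by (simp add: J_def power2_diff mult.commute)
  qed
  have bdd: "bdd_below (J ` carrier H)"
    using J_lower by (auto intro!: bdd_belowI[where m = "- b\<^sup>2"])
  have d_le: "d \<le> J x" if "x \<in> carrier H" for x
    using bdd that by (simp add: d_def cInf_lower)
  have "\<exists>x\<in>carrier H. J x < d + inverse (real (Suc n))" for n
  proof -
    have "J ` carrier H \<noteq> {}"
      using M.zero_closed by blast
    from cInf_lessD[OF this, of "d + inverse (real (Suc n))"] show ?thesis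
      by (auto simp: d_def)
  qed
  then obtain \<sigma> where \<sigma>: "\<And>n. \<sigma> n \<in> carrier H" "\<And>n. J (\<sigma> n) < d + inverse (real (Suc n))"
    by metis
  \<comment> \<open>The parallelogram law, applied to the midpoint of two nearly minimal vectors.\<close>
  have para: "(hnorm H (u \<ominus> v))\<^sup>2 \<le> 2 * J u + 2 * J v - 4 * d"
    if u: "u \<in> carrier H" and v: "v \<in> carrier H" for u v
  proof -
    have "J u + J v = 2 * J ((1/2) \<odot> (u \<oplus> v)) + (hnorm H (u \<ominus> v))\<^sup>2 / 2"
      using u v cinner_commute[OF u v]
      by (simp add: J_def hnorm_sq cinner_simps add scale field_simps)
    then show ?thesis
      using d_le[of "(1/2) \<odot> (u \<oplus> v)"] u v by simp
  qed
  have cauchy: "\<exists>N. \<forall>m\<ge>N. \<forall>n\<ge>N. hnorm H (\<sigma> m \<ominus> \<sigma> n) < e" if e: "e > 0" for e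
  proof -
    define h where "h = e\<^sup>2 / 4"
    have h: "h > 0" "4 * h = e\<^sup>2"
      using e by (simp_all add: h_def)
    obtain N where N: "inverse (real (Suc N)) < h"
      using reals_Archimedean[OF h(1)] by auto
    have "hnorm H (\<sigma> m \<ominus> \<sigma> n) < e" if mn: "m \<ge> N" "n \<ge> N" for m n
    proof -
      have small: "J (\<sigma> k) < d + h" if "k \<ge> N" for k
      proof -
        have "inverse (real (Suc k)) \<le> inverse (real (Suc N))"
          using that by (intro le_imp_inverse_le) auto
        also note N
        finally show ?thesis
          using \<sigma>(2)[of k] by (simp add: algebra_simps)
      qed
      have "(hnorm H (\<sigma> m \<ominus> \<sigma> n))\<^sup>2 < 4 * h"
        using para[OF \<sigma>(1)[of m] \<sigma>(1)[of n]] small[OF mn(1)] small[OF mn(2)] by linarith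
      then show ?thesis
        using e h(2) by (intro power2_less_imp_less[of _ e]) simp_all
    qed
    then show ?thesis
      by blast
  qed
  obtain z where z: "z \<in> carrier H" and lim: "(\<lambda>n. hnorm H (\<sigma> n \<ominus> z)) \<longlonglongrightarrow> 0"
    using complete \<sigma>(1) cauchy unfolding mcomplete_iff by blast
  have "(\<lambda>n. J (\<sigma> n)) \<longlonglongrightarrow> J z"
    unfolding J_def
    by (intro tendsto_intros tendsto_hnorm[OF \<sigma>(1) z lim]
        tendsto_bounded_additive[OF \<sigma>(1) z lim add bound])
  moreover have "(\<lambda>n. d + inverse (real (Suc n))) \<longlonglongrightarrow> d"
    using tendsto_add[OF tendsto_const LIMSEQ_inverse_real_of_nat, of d] by simp
  ultimately have Jz: "J z \<le> d"
    by (rule LIMSEQ_le) (use \<sigma>(2) less_imp_le in blast)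
  have "f x = cinner H x z" if x: "x \<in> carrier H" for x
  proof -
    define w where "w = cinner H x z - f x"
    \<comment> \<open>Moving from \<open>z\<close> along \<open>x\<close> against \<open>w\<close> decreases \<open>J\<close> unless \<open>w = 0\<close>; for the step
      length \<open>t\<close>, the quadratic term is less than half of the linear one.\<close>
    define t where "t = 1 / ((hnorm H x)\<^sup>2 + 1)"
    define c where "c = - (of_real t * cnj w)"
    have pos: "0 < (hnorm H x)\<^sup>2 + 1"
      by (simp add: add_nonneg_pos)
    then have t: "t > 0" "t * (hnorm H x)\<^sup>2 < 1"
      by (simp_all add: t_def)
    have "J (z \<oplus> c \<odot> x) = J z + 2 * Re (c * w) + (cmod c)\<^sup>2 * (hnorm H x)\<^sup>2"
      using x z cinner_commute[OF x z]
      by (simp add: J_def hnorm_add_sq hnorm_smult add scale w_def cinner_simps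
          power_mult_distrib algebra_simps)
    moreover have "J z \<le> J (z \<oplus> c \<odot> x)"
      using Jz d_le[of "z \<oplus> c \<odot> x"] x z by simp
    ultimately have "0 \<le> 2 * Re (c * w) + (cmod c)\<^sup>2 * (hnorm H x)\<^sup>2"
      by linarith
    moreover have "Re (c * w) = - t * (cmod w)\<^sup>2"
      using cmod_power2[of w] by (simp add: c_def power2_eq_square[of "Re w"]
          power2_eq_square[of "Im w"] algebra_simps)
    moreover have "(cmod c)\<^sup>2 = t\<^sup>2 * (cmod w)\<^sup>2"
      using t(1) by (simp add: c_def norm_mult power_mult_distrib)
    ultimately have "0 \<le> 2 * (- t * (cmod w)\<^sup>2) + t\<^sup>2 * (cmod w)\<^sup>2 * (hnorm H x)\<^sup>2"
      by (simp only:)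
    then have "0 \<le> (t * (cmod w)\<^sup>2) * (t * (hnorm H x)\<^sup>2 - 2)"
      by (simp add: algebra_simps power2_eq_square[of t])
    with t(2) have "t * (cmod w)\<^sup>2 \<le> 0"
      by (metis diff_less_0_iff_less linorder_not_le mult_pos_neg one_less_numeral_iff
          order_less_trans semiring_norm(76))
    with t(1) have "w = 0"
      by (simp add: mult_le_0_iff)
    then show ?thesis
      by (simp add: w_def)
  qed
  with z show ?thesis
    by blast
qed

section \<open>Bounded operators and their adjoints\<close>

lemma op_closed: "\<lbrakk>T \<in> bounded_ops H K; x \<in> carrier H\<rbrakk> \<Longrightarrow> T x \<in> carrier K"
  and op_add: "\<lbrakk>T \<in> bounded_ops H K; x \<in> carrier H; y \<in> carrier H\<rbrakk>
    \<Longrightarrow> T (x \<oplus>\<^bsub>H\<^esub> y) = T x \<oplus>\<^bsub>K\<^esub> T y"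
  and op_smult: "\<lbrakk>T \<in> bounded_ops H K; x \<in> carrier H\<rbrakk> \<Longrightarrow> T (c \<odot>\<^bsub>H\<^esub> x) = c \<odot>\<^bsub>K\<^esub> T x"
  by (auto simp: bounded_ops_def)

lemma op_bound:
  assumes "hilbert_space H" "T \<in> bounded_ops H K"
  shows "\<exists>b>0. \<forall>x\<in>carrier H. hnorm K (T x) \<le> b * hnorm H x"
proof -
  interpret H: hilbert_space H by fact
  from assms(2) obtain b where b: "\<forall>x\<in>carrier H. hnorm K (T x) \<le> b * hnorm H x"
    unfolding bounded_ops_def by blast
  have "hnorm K (T x) \<le> max b 1 * hnorm H x" if "x \<in> carrier H" for x
    using bspec[OF b that] mult_right_mono[of b "max b 1" "hnorm H x"] that by simp
  then show ?thesis
    by (intro exI[of _ "max b 1"]) auto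
qed

lemma bounded_opsI:
  assumes "\<And>x. x \<in> carrier H \<Longrightarrow> T x \<in> carrier K"
    and "\<And>x y. \<lbrakk>x \<in> carrier H; y \<in> carrier H\<rbrakk> \<Longrightarrow> T (x \<oplus>\<^bsub>H\<^esub> y) = T x \<oplus>\<^bsub>K\<^esub> T y"
    and "\<And>c x. x \<in> carrier H \<Longrightarrow> T (c \<odot>\<^bsub>H\<^esub> x) = c \<odot>\<^bsub>K\<^esub> T x"
    and "\<And>x. x \<in> carrier H \<Longrightarrow> hnorm K (T x) \<le> b * hnorm H x"
  shows "T \<in> bounded_ops H K"
  unfolding bounded_ops_def using assms by blast

lemma op_diff:
  assumes "hilbert_space H" "hilbert_space K" "T \<in> bounded_ops H K" "x \<in> carrier H" "y \<in> carrier H"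
  shows "T (x \<ominus>\<^bsub>H\<^esub> y) = T x \<ominus>\<^bsub>K\<^esub> T y"
proof -
  interpret H: hilbert_space H by fact
  interpret K: hilbert_space K by fact
  show ?thesis
    using assms(3-) by (simp add: a_minus_def op_add op_smult op_closed
        H.minus_eq_smult K.minus_eq_smult)
qed

lemma op_zero:
  assumes "hilbert_space H" "hilbert_space K" "T \<in> bounded_ops H K"
  shows "T \<zero>\<^bsub>H\<^esub> = \<zero>\<^bsub>K\<^esub>"
proof -
  interpret H: hilbert_space H by fact
  interpret K: hilbert_space K by fact
  have "T \<zero>\<^bsub>H\<^esub> \<in> carrier K"
    using assms(3) by (simp add: op_closed)
  then show ?thesis
    using op_smult[OF assms(3), of "\<zero>\<^bsub>H\<^esub>" 0] H.smult_l_null[of "\<zero>\<^bsub>H\<^esub>"]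
      K.smult_l_null[of "T \<zero>\<^bsub>H\<^esub>"] by simp
qed

lemma op_comp:
  assumes "hilbert_space G" "hilbert_space H" "S \<in> bounded_ops G H" "T \<in> bounded_ops H K"
  shows "T \<circ> S \<in> bounded_ops G K"
proof -
  interpret G: hilbert_space G by fact
  obtain b where b: "hnorm H (S x) \<le> b * hnorm G x" if "x \<in> carrier G" for x
    using op_bound[OF assms(1,3)] by blast
  obtain c where c: "c > 0" "hnorm K (T x) \<le> c * hnorm H x" if "x \<in> carrier H" for x
    using op_bound[OF assms(2,4)] by blast
  have "hnorm K (T (S x)) \<le> (c * b) * hnorm G x" if x: "x \<in> carrier G" for x
  proof -
    have "hnorm K (T (S x)) \<le> c * hnorm H (S x)"
      using c(2) op_closed[OF assms(3) x] by blast
    also have "\<dots> \<le> c * (b * hnorm G x)"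
      using b[OF x] c(1)[OF op_closed[OF assms(3) x]] by (intro mult_left_mono) auto
    finally show ?thesis by (simp add: mult.assoc)
  qed
  then show ?thesis
    using assms(3,4) by (intro bounded_opsI) (auto simp: op_closed op_add op_smult)
qed

lemma tendsto_op:
  assumes "hilbert_space H" "hilbert_space K" "T \<in> bounded_ops H K"
    and "\<And>n. \<sigma> n \<in> carrier H" "l \<in> carrier H" "(\<lambda>n. hnorm H (\<sigma> n \<ominus>\<^bsub>H\<^esub> l)) \<longlonglongrightarrow> 0"
  shows "(\<lambda>n. hnorm K (T (\<sigma> n) \<ominus>\<^bsub>K\<^esub> T l)) \<longlonglongrightarrow> 0"
proof -
  interpret H: hilbert_space H by fact
  interpret K: hilbert_space K by fact
  obtain b where b: "b > 0" "\<forall>x\<in>carrier H. hnorm K (T x) \<le> b * hnorm H x"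
    using op_bound[OF assms(1,3)] by blast
  have "norm (hnorm K (T (\<sigma> n) \<ominus>\<^bsub>K\<^esub> T l)) \<le> b * hnorm H (\<sigma> n \<ominus>\<^bsub>H\<^esub> l)" for n
    using bspec[OF b(2), of "\<sigma> n \<ominus>\<^bsub>H\<^esub> l"] assms(4,5) op_closed[OF assms(3)]
    by (simp add: op_diff[OF assms(1-3)])
  then have "\<forall>\<^sub>F n in sequentially.
      norm (hnorm K (T (\<sigma> n) \<ominus>\<^bsub>K\<^esub> T l)) \<le> b * hnorm H (\<sigma> n \<ominus>\<^bsub>H\<^esub> l)"
    by simp
  moreover have "(\<lambda>n. b * hnorm H (\<sigma> n \<ominus>\<^bsub>H\<^esub> l)) \<longlonglongrightarrow> 0"
    using tendsto_mult_left[OF assms(6), of b] by simp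
  ultimately show ?thesis
    by (rule Lim_null_comparison)
qed

lemma inj_on_iff_kernel:
  assumes "hilbert_space H" "hilbert_space K" "T \<in> bounded_ops H K"
  shows "inj_on T (carrier H) \<longleftrightarrow> (\<forall>x\<in>carrier H. T x = \<zero>\<^bsub>K\<^esub> \<longrightarrow> x = \<zero>\<^bsub>H\<^esub>)"
proof -
  interpret H: hilbert_space H by fact
  interpret K: hilbert_space K by fact
  note closed = op_closed[OF assms(3)]
  show ?thesis
  proof
    assume "inj_on T (carrier H)"
    then show "\<forall>x\<in>carrier H. T x = \<zero>\<^bsub>K\<^esub> \<longrightarrow> x = \<zero>\<^bsub>H\<^esub>"
      using op_zero[OF assms] H.M.zero_closed by (metis inj_onD)
  next
    assume ker: "\<forall>x\<in>carrier H. T x = \<zero>\<^bsub>K\<^esub> \<longrightarrow> x = \<zero>\<^bsub>H\<^esub>"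
    show "inj_on T (carrier H)"
    proof (rule inj_onI)
      fix x y assume xy: "x \<in> carrier H" "y \<in> carrier H" "T x = T y"
      then have "T (x \<ominus>\<^bsub>H\<^esub> y) = \<zero>\<^bsub>K\<^esub>"
        using K.diff_eq_0[of "T x" "T y"] by (simp add: op_diff[OF assms] closed)
      with ker have "x \<ominus>\<^bsub>H\<^esub> y = \<zero>\<^bsub>H\<^esub>"
        using xy by simp
      then show "x = y"
        using xy by (simp add: H.diff_eq_0)
    qed
  qed
qed

lemma adjoint_eqI:
  assumes "hilbert_space H" "x \<in> carrier H"
    and "\<And>z. z \<in> carrier H \<Longrightarrow> cinner K (T z) y = cinner H z x"
  shows "adjoint H K T y = x"
proof -
  interpret H: hilbert_space H by fact
  show ?thesis
    unfolding adjoint_def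
    by (rule the_equality) (use assms(2,3) in \<open>auto intro: H.cinner_eqI\<close>)
qed

lemma adjoint_spec:
  assumes "hilbert_space H" "hilbert_space K" "T \<in> bounded_ops H K" "y \<in> carrier K"
  shows "adjoint H K T y \<in> carrier H \<and>
    (\<forall>z\<in>carrier H. cinner K (T z) y = cinner H z (adjoint H K T y))"
proof -
  interpret H: hilbert_space H by fact
  interpret K: hilbert_space K by fact
  obtain b where b: "b > 0" "\<forall>x\<in>carrier H. hnorm K (T x) \<le> b * hnorm H x"
    using op_bound[OF assms(1,3)] by blast
  have "\<exists>z\<in>carrier H. \<forall>x\<in>carrier H. cinner K (T x) y = cinner H x z"
  proof (rule H.Riesz_representation)
    fix x assume x: "x \<in> carrier H"
    have "cmod (cinner K (T x) y) \<le> hnorm K (T x) * hnorm K y"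
      by (rule K.Cauchy_Schwarz) (use assms x in \<open>auto simp: op_closed\<close>)
    also have "\<dots> \<le> (b * hnorm H x) * hnorm K y"
      using b(2) x assms(4) by (intro mult_right_mono) auto
    finally show "cmod (cinner K (T x) y) \<le> (b * hnorm K y) * hnorm H x"
      by (simp add: ac_simps)
  qed (use assms in \<open>simp_all add: op_add op_smult op_closed K.cinner_simps\<close>)
  then obtain z where z: "z \<in> carrier H" "\<And>x. x \<in> carrier H \<Longrightarrow> cinner K (T x) y = cinner H x z"
    by blast
  have "adjoint H K T y = z"
    by (rule adjoint_eqI[OF assms(1)]) (fact z)+
  with z show ?thesis
    by simp
qed

lemma adjoint_closed:
  "\<lbrakk>hilbert_space H; hilbert_space K; T \<in> bounded_ops H K; y \<in> carrier K\<rbrakk>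
    \<Longrightarrow> adjoint H K T y \<in> carrier H"
  by (rule adjoint_spec[THEN conjunct1])

lemma cinner_adjoint_right:
  "\<lbrakk>hilbert_space H; hilbert_space K; T \<in> bounded_ops H K; x \<in> carrier H; y \<in> carrier K\<rbrakk>
    \<Longrightarrow> cinner H x (adjoint H K T y) = cinner K (T x) y"
  by (rule adjoint_spec[THEN conjunct2, THEN bspec, symmetric])

lemma cinner_adjoint_left:
  assumes "hilbert_space H" "hilbert_space K" "T \<in> bounded_ops H K" "x \<in> carrier H" "y \<in> carrier K"
  shows "cinner H (adjoint H K T y) x = cinner K y (T x)"
proof -
  interpret H: hilbert_space H by fact
  interpret K: hilbert_space K by fact
  show ?thesis
    using H.cinner_commute[of x "adjoint H K T y"] K.cinner_commute[of "T x" y] assms(3-)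
      adjoint_closed[OF assms(1,2,3,5)] cinner_adjoint_right[OF assms]
    by (simp add: op_closed)
qed

lemma adjoint_bounded_op:
  assumes "hilbert_space H" "hilbert_space K" "T \<in> bounded_ops H K"
  shows "adjoint H K T \<in> bounded_ops K H"
proof -
  interpret H: hilbert_space H by fact
  interpret K: hilbert_space K by fact
  note [simp] = adjoint_closed[OF assms] cinner_adjoint_right[OF assms] op_closed[OF assms(3)]
  obtain b where b: "b > 0" "\<forall>x\<in>carrier H. hnorm K (T x) \<le> b * hnorm H x"
    using op_bound[OF assms(1,3)] by blast
  show ?thesis
  proof (rule bounded_opsI)
    fix x assume x: "x \<in> carrier K"
    let ?y = "adjoint H K T x"
    have "(hnorm H ?y)\<^sup>2 = Re (cinner K (T ?y) x)"
      using x by (simp add: H.hnorm_sq)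
    also have "\<dots> \<le> hnorm K (T ?y) * hnorm K x"
      using K.Cauchy_Schwarz[of "T ?y" x] x complex_Re_le_cmod order_trans by simp blast
    also have "\<dots> \<le> (b * hnorm H ?y) * hnorm K x"
      using b(2) x by (intro mult_right_mono) auto
    finally have *: "hnorm H ?y * hnorm H ?y \<le> hnorm H ?y * (b * hnorm K x)"
      by (simp add: power2_eq_square ac_simps)
    show "hnorm H ?y \<le> b * hnorm K x"
    proof (cases "hnorm H ?y = 0")
      case True
      then show ?thesis using b(1) x by simp
    next
      case False
      then have "hnorm H ?y > 0"
        using H.hnorm_nonneg[of ?y] x by (simp add: less_le)
      with * show ?thesis by simp
    qed
  qed (auto intro!: H.cinner_eqI simp: H.cinner_simps K.cinner_simps)
qed

lemma adjoint_adjoint: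
  assumes "hilbert_space H" "hilbert_space K" "T \<in> bounded_ops H K" "x \<in> carrier H"
  shows "adjoint K H (adjoint H K T) x = T x"
  by (rule adjoint_eqI) (use assms in \<open>simp_all add: op_closed cinner_adjoint_left\<close>)

lemma adjoint_comp_eq_0_iff:
  assumes "hilbert_space H" "hilbert_space K" "T \<in> bounded_ops H K" "x \<in> carrier H"
  shows "adjoint H K T (T x) = \<zero>\<^bsub>H\<^esub> \<longleftrightarrow> T x = \<zero>\<^bsub>K\<^esub>"
proof -
  interpret H: hilbert_space H by fact
  interpret K: hilbert_space K by fact
  have Tx: "T x \<in> carrier K"
    using assms(3,4) by (rule op_closed)
  have "cinner H x (adjoint H K T (T x)) = cinner K (T x) (T x)"
    by (rule cinner_adjoint_right[OF assms Tx])
  moreover have "adjoint H K T \<zero>\<^bsub>K\<^esub> = \<zero>\<^bsub>H\<^esub>"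
    using assms(1-3) by (intro op_zero adjoint_bounded_op)
  ultimately show ?thesis
    using K.cinner_self_eq_0[OF Tx] assms(4) by auto
qed

lemma comp_adjoint_eq_0_iff:
  assumes "hilbert_space H" "hilbert_space K" "T \<in> bounded_ops H K" "y \<in> carrier K"
  shows "T (adjoint H K T y) = \<zero>\<^bsub>K\<^esub> \<longleftrightarrow> adjoint H K T y = \<zero>\<^bsub>H\<^esub>"
  using adjoint_comp_eq_0_iff[OF assms(2,1) adjoint_bounded_op[OF assms(1-3)] assms(4)]
    adjoint_adjoint[OF assms(1-3)] adjoint_closed[OF assms] by simp

section \<open>Closed subspaces, orthogonal projection and direct sums\<close>

lemma hilbert_subspace:
  assumes "hilbert_space H" and sub: "M \<subseteq> carrier H" and zero: "\<zero>\<^bsub>H\<^esub> \<in> M"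
    and add: "\<And>x y. \<lbrakk>x \<in> M; y \<in> M\<rbrakk> \<Longrightarrow> x \<oplus>\<^bsub>H\<^esub> y \<in> M"
    and smult: "\<And>c x. x \<in> M \<Longrightarrow> c \<odot>\<^bsub>H\<^esub> x \<in> M"
    and closed: "closedin (Metric_space.mtopology (carrier H) (hdist H)) M"
  shows "hilbert_space (H\<lparr>carrier := M\<rparr>)"
proof -
  interpret H: hilbert_space H by fact
  let ?M = "H\<lparr>carrier := M\<rparr>"
  have "submodule M complex_ring H"
  proof (rule H.submoduleI)
    show "\<ominus>\<^bsub>H\<^esub> a \<in> M" if "a \<in> M" for a
      using smult[OF that, of "-1"] sub that by (simp add: H.minus_eq_smult subsetD)
  qed (use sub zero add smult in auto)
  then have "Module.module complex_ring ?M"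
    using H.module_axioms by (rule submodule.submodule_is_module)
  then interpret M: complex_inner_space ?M
    using sub by (intro complex_inner_space.intro complex_inner_space_axioms.intro)
      (auto simp: subset_iff H.cinner_simps H.cinner_pos intro: H.cinner_commute)
  have diff: "x \<ominus>\<^bsub>?M\<^esub> y = x \<ominus>\<^bsub>H\<^esub> y" if "x \<in> M" "y \<in> M" for x y
    using that sub M.minus_eq_smult[of y] H.minus_eq_smult[of y] by (auto simp: a_minus_def)
  have norm: "hnorm ?M = hnorm H"
    by (simp add: hnorm_def fun_eq_iff)
  have "M.metric.mcomplete"
    unfolding M.mcomplete_iff
  proof (intro allI impI, elim conjE)
    fix \<sigma> :: "nat \<Rightarrow> _"
    assume \<sigma>: "\<forall>n. \<sigma> n \<in> carrier ?M"
      and cauchy: "\<forall>e>0. \<exists>N. \<forall>m\<ge>N. \<forall>n\<ge>N. hnorm ?M (\<sigma> m \<ominus>\<^bsub>?M\<^esub> \<sigma> n) < e"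
    from \<sigma> have \<sigma>M: "\<sigma> n \<in> M" for n
      by simp
    then have \<sigma>H: "\<sigma> n \<in> carrier H" for n
      using sub by blast
    from cauchy have "\<forall>e>0. \<exists>N. \<forall>m\<ge>N. \<forall>n\<ge>N. hnorm H (\<sigma> m \<ominus>\<^bsub>H\<^esub> \<sigma> n) < e"
      by (simp add: norm diff \<sigma>M)
    then obtain l where l: "l \<in> carrier H" "(\<lambda>n. hnorm H (\<sigma> n \<ominus>\<^bsub>H\<^esub> l)) \<longlonglongrightarrow> 0"
      using H.complete \<sigma>H unfolding H.mcomplete_iff by blast
    then have "l \<in> M"
      using closed \<sigma>M unfolding H.closedin_iff by blast
    with l show "\<exists>l\<in>carrier ?M. (\<lambda>n. hnorm ?M (\<sigma> n \<ominus>\<^bsub>?M\<^esub> l)) \<longlonglongrightarrow> 0"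
      by (auto simp: norm diff \<sigma>M)
  qed
  then show ?thesis
    by unfold_locales
qed

lemma hilbert_range:
  assumes "hilbert_space H" "hilbert_space K" "T \<in> bounded_ops H K" "closed_range H K T"
  shows "hilbert_space (K\<lparr>carrier := T ` carrier H\<rparr>)"
proof -
  interpret H: hilbert_space H by fact
  interpret K: hilbert_space K by fact
  note T = op_closed[OF assms(3)] op_zero[OF assms(1-3)] op_add[OF assms(3)] op_smult[OF assms(3)]
  show ?thesis
  proof (rule hilbert_subspace[OF assms(2)])
    show "\<zero>\<^bsub>K\<^esub> \<in> T ` carrier H"
      by (rule image_eqI[of _ _ "\<zero>\<^bsub>H\<^esub>"]) (simp_all add: T)
    show "x \<oplus>\<^bsub>K\<^esub> y \<in> T ` carrier H" if "x \<in> T ` carrier H" "y \<in> T ` carrier H" for x y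
      using that T(3)[symmetric] by force
    show "c \<odot>\<^bsub>K\<^esub> x \<in> T ` carrier H" if "x \<in> T ` carrier H" for c x
      using that T(4)[symmetric] by force
  qed (use assms(4) T in \<open>auto simp: closed_range_def\<close>)
qed

lemma hilbert_kernel:
  assumes "hilbert_space H" "hilbert_space K" "T \<in> bounded_ops H K"
  shows "hilbert_space (H\<lparr>carrier := {x \<in> carrier H. T x = \<zero>\<^bsub>K\<^esub>}\<rparr>)"
proof -
  interpret H: hilbert_space H by fact
  interpret K: hilbert_space K by fact
  note T = op_closed[OF assms(3)] op_zero[OF assms(1-3)] op_add[OF assms(3)] op_smult[OF assms(3)]
  show ?thesis
  proof (rule hilbert_subspace[OF assms(1)])
    show "closedin H.metric.mtopology {x \<in> carrier H. T x = \<zero>\<^bsub>K\<^esub>}"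
      unfolding H.closedin_iff
    proof (intro conjI allI impI; (elim conjE)?)
      fix \<sigma> l
      assume \<sigma>: "\<forall>n. \<sigma> n \<in> {x \<in> carrier H. T x = \<zero>\<^bsub>K\<^esub>}"
        and l: "l \<in> carrier H" "(\<lambda>n. hnorm H (\<sigma> n \<ominus>\<^bsub>H\<^esub> l)) \<longlonglongrightarrow> 0"
      then have "(\<lambda>n. hnorm K (T (\<sigma> n) \<ominus>\<^bsub>K\<^esub> T l)) \<longlonglongrightarrow> 0"
        by (intro tendsto_op[OF assms]) auto
      moreover have "(\<lambda>n. hnorm K (T (\<sigma> n) \<ominus>\<^bsub>K\<^esub> \<zero>\<^bsub>K\<^esub>)) \<longlonglongrightarrow> 0"
        using \<sigma> K.diff_eq_0[of "\<zero>\<^bsub>K\<^esub>" "\<zero>\<^bsub>K\<^esub>"] by simp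
      ultimately have "T l = \<zero>\<^bsub>K\<^esub>"
        using K.hlim_unique[of "\<lambda>n. T (\<sigma> n)" "T l" "\<zero>\<^bsub>K\<^esub>"] \<sigma> T(1) l(1) by auto
      with l(1) show "l \<in> {x \<in> carrier H. T x = \<zero>\<^bsub>K\<^esub>}"
        by simp
    qed auto
  qed (auto simp: T)
qed

text \<open>
  The projection of \<open>x\<close> represents the functional \<open>m \<mapsto> \<langle>m, x\<rangle>\<close> on \<open>M\<close>.
\<close>

lemma orthogonal_projection:
  assumes H: "hilbert_space H" and M: "hilbert_space (H\<lparr>carrier := M\<rparr>)" and sub: "M \<subseteq> carrier H"
    and x: "x \<in> carrier H"
  shows "\<exists>p\<in>M. \<forall>m\<in>M. cinner H m (x \<ominus>\<^bsub>H\<^esub> p) = 0"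
proof -
  interpret H: hilbert_space H by fact
  interpret M: hilbert_space "H\<lparr>carrier := M\<rparr>" by fact
  have "\<exists>p\<in>carrier (H\<lparr>carrier := M\<rparr>). \<forall>m\<in>carrier (H\<lparr>carrier := M\<rparr>).
      cinner H m x = cinner (H\<lparr>carrier := M\<rparr>) m p"
    by (rule M.Riesz_representation[where b = "hnorm H x"])
      (use sub x H.Cauchy_Schwarz[OF _ x]
        in \<open>auto simp: H.cinner_simps subset_iff hnorm_def mult.commute\<close>)
  then obtain p where p: "p \<in> M" "\<forall>m\<in>M. cinner H m x = cinner H m p"
    by auto
  then have "\<forall>m\<in>M. cinner H m (x \<ominus>\<^bsub>H\<^esub> p) = 0"
    using sub x by (auto simp: H.cinner_simps subset_iff)
  with p(1) show ?thesis
    by blast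
qed

lemma hsum_simps [simp]:
  "carrier (hsum K L) = carrier K \<times> carrier L"
  "\<zero>\<^bsub>hsum K L\<^esub> = (\<zero>\<^bsub>K\<^esub>, \<zero>\<^bsub>L\<^esub>)"
  "(y, z) \<oplus>\<^bsub>hsum K L\<^esub> (y', z') = (y \<oplus>\<^bsub>K\<^esub> y', z \<oplus>\<^bsub>L\<^esub> z')"
  "c \<odot>\<^bsub>hsum K L\<^esub> (y, z) = (c \<odot>\<^bsub>K\<^esub> y, c \<odot>\<^bsub>L\<^esub> z)"
  "cinner (hsum K L) (y, z) (y', z') = cinner K y y' + cinner L z z'"
  by (simp_all add: hsum_def)

lemma hilbert_hsum:
  assumes "hilbert_space K" "hilbert_space L"
  shows "hilbert_space (hsum K L)"
proof -
  interpret K: hilbert_space K by fact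
  interpret L: hilbert_space L by fact
  let ?S = "hsum K L"
  have "abelian_group ?S"
  proof (rule abelian_groupI)
    fix x assume "x \<in> carrier ?S"
    then show "\<exists>y\<in>carrier ?S. y \<oplus>\<^bsub>?S\<^esub> x = \<zero>\<^bsub>?S\<^esub>"
      by (auto intro!: bexI[of _ "(\<ominus>\<^bsub>K\<^esub> fst x, \<ominus>\<^bsub>L\<^esub> snd x)"] simp: K.M.l_neg L.M.l_neg)
  qed (auto simp: K.M.a_assoc L.M.a_assoc intro: K.M.a_comm L.M.a_comm)
  then have "Module.module complex_ring ?S"
    using K.smult_l_distr L.smult_l_distr K.smult_r_distr L.smult_r_distr
      K.smult_assoc1 L.smult_assoc1 K.smult_one L.smult_one
    by (intro moduleI K.R.is_cring) auto
  then interpret S: complex_inner_space ?S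
  proof (intro complex_inner_space.intro complex_inner_space_axioms.intro)
    fix x assume "x \<in> carrier ?S" "x \<noteq> \<zero>\<^bsub>?S\<^esub>"
    then obtain y z where x: "x = (y, z)" "y \<in> carrier K" "z \<in> carrier L"
      and nz: "y \<noteq> \<zero>\<^bsub>K\<^esub> \<or> z \<noteq> \<zero>\<^bsub>L\<^esub>"
      by (cases x) auto
    have "0 \<le> Re (cinner K y y)" "0 \<le> Re (cinner L z z)"
      using x K.hnorm_sq[of y] L.hnorm_sq[of z] by (metis zero_le_power2)+
    then show "0 < Re (cinner ?S x x)"
      using x nz K.cinner_pos[of y] L.cinner_pos[of z] by auto
  qed (auto simp: K.cinner_simps L.cinner_simps algebra_simps
      intro!: arg_cong2[where f = "(+)"] K.cinner_commute L.cinner_commute)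
  have diff: "(y, z) \<ominus>\<^bsub>?S\<^esub> (y', z') = (y \<ominus>\<^bsub>K\<^esub> y', z \<ominus>\<^bsub>L\<^esub> z')"
    if "y \<in> carrier K" "z \<in> carrier L" "y' \<in> carrier K" "z' \<in> carrier L" for y z y' z'
    using that S.minus_eq_smult[of "(y', z')"] K.minus_eq_smult[of y'] L.minus_eq_smult[of z']
    by (simp add: a_minus_def)
  have norm: "hnorm ?S (y, z) = sqrt ((hnorm K y)\<^sup>2 + (hnorm L z)\<^sup>2)"
    if "y \<in> carrier K" "z \<in> carrier L" for y z
    using that by (simp add: hnorm_def[of ?S] K.hnorm_sq L.hnorm_sq)
  have "S.metric.mcomplete"
    unfolding S.mcomplete_iff
  proof (intro allI impI, elim conjE)
    fix \<sigma> :: "nat \<Rightarrow> _"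
    assume \<sigma>: "\<forall>n. \<sigma> n \<in> carrier ?S"
      and cauchy: "\<forall>e>0. \<exists>N. \<forall>m\<ge>N. \<forall>n\<ge>N. hnorm ?S (\<sigma> m \<ominus>\<^bsub>?S\<^esub> \<sigma> n) < e"
    define y z where "y n = fst (\<sigma> n)" and "z n = snd (\<sigma> n)" for n
    have yz: "y n \<in> carrier K" "z n \<in> carrier L" for n
      using \<sigma> by (auto simp: y_def z_def mem_Times_iff)
    have \<sigma>_eq: "\<sigma> n = (y n, z n)" for n
      by (simp add: y_def z_def)
    have le: "hnorm K (y m \<ominus>\<^bsub>K\<^esub> y n) \<le> hnorm ?S (\<sigma> m \<ominus>\<^bsub>?S\<^esub> \<sigma> n)"
      "hnorm L (z m \<ominus>\<^bsub>L\<^esub> z n) \<le> hnorm ?S (\<sigma> m \<ominus>\<^bsub>?S\<^esub> \<sigma> n)" for m n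
      using yz by (auto simp: \<sigma>_eq diff norm intro: real_le_rsqrt)
    have dominated: "\<forall>e>0. \<exists>N. \<forall>m\<ge>N. \<forall>n\<ge>N. d m n < e"
      if "\<And>m n. d m n \<le> hnorm ?S (\<sigma> m \<ominus>\<^bsub>?S\<^esub> \<sigma> n)" for d :: "nat \<Rightarrow> nat \<Rightarrow> real"
    proof (intro allI impI)
      fix e :: real assume "e > 0"
      with cauchy obtain N where "\<forall>m\<ge>N. \<forall>n\<ge>N. hnorm ?S (\<sigma> m \<ominus>\<^bsub>?S\<^esub> \<sigma> n) < e"
        by blast
      then show "\<exists>N. \<forall>m\<ge>N. \<forall>n\<ge>N. d m n < e"
        using le_less_trans[OF that] by blast
    qed
    obtain k where k: "k \<in> carrier K" "(\<lambda>n. hnorm K (y n \<ominus>\<^bsub>K\<^esub> k)) \<longlonglongrightarrow> 0"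
      using K.complete[unfolded K.mcomplete_iff, rule_format, of y] dominated[OF le(1)] yz(1) by blast
    obtain l where l: "l \<in> carrier L" "(\<lambda>n. hnorm L (z n \<ominus>\<^bsub>L\<^esub> l)) \<longlonglongrightarrow> 0"
      using L.complete[unfolded L.mcomplete_iff, rule_format, of z] dominated[OF le(2)] yz(2) by blast
    have "(\<lambda>n. sqrt ((hnorm K (y n \<ominus>\<^bsub>K\<^esub> k))\<^sup>2 + (hnorm L (z n \<ominus>\<^bsub>L\<^esub> l))\<^sup>2)) \<longlonglongrightarrow>
        sqrt (0\<^sup>2 + 0\<^sup>2)"
      by (intro tendsto_intros k l)
    with k(1) l(1) show "\<exists>x\<in>carrier ?S. (\<lambda>n. hnorm ?S (\<sigma> n \<ominus>\<^bsub>?S\<^esub> x)) \<longlonglongrightarrow> 0"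
      using yz by (intro bexI[of _ "(k, l)"]) (auto simp: \<sigma>_eq diff norm)
  qed
  then show ?thesis
    by unfold_locales
qed

section \<open>Uniform boundedness and operators bounded below\<close>

text \<open>
  \<open>T\<close> is bounded below if \<open>c \<parallel>x\<parallel> \<le> \<parallel>T x\<parallel>\<close> for some constant \<open>c > 0\<close>. Linearity and boundedness of \<open>T\<close> are
  not part of the notion.
\<close>

definition bounded_below :: "'a hilbert \<Rightarrow> 'b hilbert \<Rightarrow> ('a \<Rightarrow> 'b) \<Rightarrow> bool" where
  "bounded_below H K T \<longleftrightarrow> (\<exists>c>0. \<forall>x\<in>carrier H. c * hnorm H x \<le> hnorm K (T x))"

lemma bounded_below_inj:
  assumes "hilbert_space H" "hilbert_space K" "T \<in> bounded_ops H K" "bounded_below H K T"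
  shows "inj_on T (carrier H)"
proof -
  interpret H: hilbert_space H by fact
  interpret K: hilbert_space K by fact
  obtain c where c: "c > 0" "\<forall>x\<in>carrier H. c * hnorm H x \<le> hnorm K (T x)"
    using assms(4) unfolding bounded_below_def by blast
  have "x = \<zero>\<^bsub>H\<^esub>" if x: "x \<in> carrier H" "T x = \<zero>\<^bsub>K\<^esub>" for x
  proof -
    have "c * hnorm H x \<le> 0"
      using bspec[OF c(2) x(1)] x(2) by simp
    then have "hnorm H x = 0"
      using c(1) H.hnorm_nonneg[OF x(1)] by (simp add: mult_le_0_iff)
    then show ?thesis
      using H.hnorm_eq_0[OF x(1)] by simp
  qed
  then show ?thesis
    using inj_on_iff_kernel[OF assms(1-3)] by blast
qed

lemma bounded_below_closed_range:
  assumes "hilbert_space H" "hilbert_space K" "T \<in> bounded_ops H K" "bounded_below H K T"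
  shows "closed_range H K T"
proof -
  interpret H: hilbert_space H by fact
  interpret K: hilbert_space K by fact
  note closed = op_closed[OF assms(3)]
  obtain c where c: "c > 0" "\<forall>x\<in>carrier H. c * hnorm H x \<le> hnorm K (T x)"
    using assms(4) unfolding bounded_below_def by blast
  show ?thesis
    unfolding closed_range_def K.closedin_iff
  proof (intro conjI allI impI; (elim conjE)?)
    show "T ` carrier H \<subseteq> carrier K"
      using closed by blast
    fix \<sigma> l
    assume "\<forall>n. \<sigma> n \<in> T ` carrier H" and l: "l \<in> carrier K"
      and lim: "(\<lambda>n. hnorm K (\<sigma> n \<ominus>\<^bsub>K\<^esub> l)) \<longlonglongrightarrow> 0"
    then obtain x where x: "\<And>n. x n \<in> carrier H" and \<sigma>: "\<And>n. \<sigma> n = T (x n)"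
      unfolding image_iff by metis
    have \<sigma>K: "\<sigma> n \<in> carrier K" for n
      using x closed \<sigma> by simp
    then have "K.metric.MCauchy \<sigma>"
      using K.metric.convergent_imp_MCauchy[of \<sigma> l] K.limitin_iff[of \<sigma> l] l lim by blast
    then have cauchy: "\<forall>e>0. \<exists>N. \<forall>m\<ge>N. \<forall>n\<ge>N. hnorm K (\<sigma> m \<ominus>\<^bsub>K\<^esub> \<sigma> n) < e"
      by (simp add: K.MCauchy_iff)
    have "\<exists>N. \<forall>m\<ge>N. \<forall>n\<ge>N. hnorm H (x m \<ominus>\<^bsub>H\<^esub> x n) < e" if e: "e > 0" for e
    proof -
      obtain N where N: "\<forall>m\<ge>N. \<forall>n\<ge>N. hnorm K (\<sigma> m \<ominus>\<^bsub>K\<^esub> \<sigma> n) < c * e"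
        using cauchy mult_pos_pos[OF c(1) e] by blast
      have "hnorm H (x m \<ominus>\<^bsub>H\<^esub> x n) < e" if "m \<ge> N" "n \<ge> N" for m n
      proof -
        have "c * hnorm H (x m \<ominus>\<^bsub>H\<^esub> x n) \<le> hnorm K (\<sigma> m \<ominus>\<^bsub>K\<^esub> \<sigma> n)"
          using bspec[OF c(2), of "x m \<ominus>\<^bsub>H\<^esub> x n"] x by (simp add: \<sigma> op_diff[OF assms(1-3)])
        also have "\<dots> < c * e"
          using N that by blast
        finally show ?thesis
          using c(1) by simp
      qed
      then show ?thesis by blast
    qed
    then obtain z where z: "z \<in> carrier H" "(\<lambda>n. hnorm H (x n \<ominus>\<^bsub>H\<^esub> z)) \<longlonglongrightarrow> 0"
      using H.complete[unfolded H.mcomplete_iff, rule_format, of x] x by blast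
    have "(\<lambda>n. hnorm K (\<sigma> n \<ominus>\<^bsub>K\<^esub> T z)) \<longlonglongrightarrow> 0"
      using tendsto_op[OF assms(1-3) x z] by (simp add: \<sigma>)
    then have "l = T z"
      using K.hlim_unique[OF \<sigma>K l closed[OF z(1)] lim] by blast
    with z(1) show "l \<in> T ` carrier H"
      by blast
  qed
qed

text \<open>
  The uniform boundedness principle for the functionals \<open>w \<mapsto> \<langle>w, y\<rangle>\<close> with \<open>y \<in> S\<close>: a pointwise bounded
  set of vectors is bounded in norm, by the Baire category theorem.
\<close>

lemma (in hilbert_space) uniform_boundedness:
  assumes S: "S \<subseteq> carrier H"
    and pointwise: "\<And>w. w \<in> carrier H \<Longrightarrow> \<exists>b. \<forall>y\<in>S. cmod (cinner H w y) \<le> b"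
  shows "\<exists>b>0. \<forall>y\<in>S. hnorm H y \<le> b"
proof -
  define F where "F n = {w \<in> carrier H. \<forall>y\<in>S. cmod (cinner H w y) \<le> real n}" for n :: nat
  have closed: "closedin metric.mtopology (F n)" for n
    unfolding closedin_iff
  proof (intro conjI allI impI; (elim conjE)?)
    show "F n \<subseteq> carrier H"
      by (auto simp: F_def)
    fix \<sigma> l
    assume \<sigma>: "\<forall>k. \<sigma> k \<in> F n" and l: "l \<in> carrier H" "(\<lambda>k. hnorm H (\<sigma> k \<ominus> l)) \<longlonglongrightarrow> 0"
    have "cmod (cinner H l y) \<le> real n" if y: "y \<in> S" for y
    proof (rule LIMSEQ_le_const2)
      show "(\<lambda>k. cmod (cinner H (\<sigma> k) y)) \<longlonglongrightarrow> cmod (cinner H l y)"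
        using \<sigma> l y S by (intro tendsto_norm tendsto_cinner_left) (auto simp: F_def)
      show "\<exists>N. \<forall>k\<ge>N. cmod (cinner H (\<sigma> k) y) \<le> real n"
        using \<sigma> y by (auto simp: F_def)
    qed
    with l(1) show "l \<in> F n"
      by (simp add: F_def)
  qed
  have "\<Union> (range F) = carrier H"
  proof
    show "carrier H \<subseteq> \<Union> (range F)"
    proof
      fix w assume w: "w \<in> carrier H"
      obtain b where b: "\<forall>y\<in>S. cmod (cinner H w y) \<le> b"
        using pointwise[OF w] by blast
      obtain n where "b \<le> real n"
        using real_arch_simple by blast
      with b w have "w \<in> F n"
        by (auto simp: F_def intro: order_trans)
      then show "w \<in> \<Union> (range F)"
        by blast
    qed
  qed (auto simp: F_def)
  then have "metric.mtopology interior_of \<Union> (range F) \<noteq> {}"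
    using interior_of_topspace[of metric.mtopology] M.zero_closed by auto
  then obtain n where n: "metric.mtopology interior_of (F n) \<noteq> {}"
    using metric.metric_Baire_category_alt[OF complete, of "range F"] closed
    by (metis countableI_type countable_image image_iff)
  then obtain w U where U: "openin metric.mtopology U" "w \<in> U" "U \<subseteq> F n"
    unfolding interior_of_def by blast
  then obtain r where "r > 0" "metric.mball w r \<subseteq> U"
    unfolding metric.openin_mtopology by blast
  with U have wr: "w \<in> carrier H" "r > 0" "metric.mball w r \<subseteq> F n"
    by (auto simp: F_def)
  have w: "w \<in> F n"
    using wr by auto
  have "hnorm H y \<le> 4 * real n / r + 1" if y: "y \<in> S" for y
  proof (cases "y = \<zero>")
    case True
    then show ?thesis
      using wr(2) by simp
  next
    case False
    have yH: "y \<in> carrier H"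
      using y S by blast
    define s where "s = hnorm H y"
    have s: "s > 0"
      using False yH hnorm_nonneg[of y] hnorm_eq_0[of y] by (simp add: s_def less_le)
    \<comment> \<open>A multiple of \<open>y\<close> of norm \<open>r / 2\<close>, so that \<open>w + u\<close> stays in the ball contained in \<open>F n\<close>.\<close>
    define u where "u = of_real (r / (2 * s)) \<odot> y"
    have u: "u \<in> carrier H"
      using yH by (simp add: u_def)
    have "hnorm H (w \<ominus> (w \<oplus> u)) = r / 2"
    proof -
      have "w \<ominus> (w \<oplus> u) = \<ominus> u"
        using wr(1) u by (intro cinner_eqI) (simp_all add: cinner_simps)
      then show ?thesis
        using u yH s wr(2) by (simp add: hnorm_minus u_def hnorm_smult s_def[symmetric]
            norm_divide norm_mult)
    qed
    then have "w \<oplus> u \<in> F n"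
      using wr u by (intro subsetD[OF wr(3)]) (simp add: metric.in_mball hdist_def)
    then have "cmod (cinner H (w \<oplus> u) y) \<le> real n" "cmod (cinner H w y) \<le> real n"
      using w y by (auto simp: F_def)
    moreover have "cinner H (w \<oplus> u) y - cinner H w y = of_real (r * s / 2)"
      using wr(1) u yH s
      by (simp add: cinner_simps u_def cinner_self s_def[symmetric] power2_eq_square)
    ultimately have "cmod (of_real (r * s / 2)) \<le> real n + real n"
      by (metis add_mono norm_triangle_ineq4 order_trans)
    then have "r * s \<le> 4 * real n"
      using wr(2) s by (simp add: norm_mult)
    then have "s \<le> 4 * real n / r"
      using wr(2) by (simp add: field_simps)
    then show ?thesis
      by (simp add: s_def)
  qed
  moreover have "4 * real n / r + 1 > 0"
    using wr(2) by (simp add: add_nonneg_pos)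
  ultimately show ?thesis
    by blast
qed

text \<open>
  The set of all \<open>y\<close> with \<open>\<parallel>T\<^sup>* y\<parallel> \<le> 1\<close> is pointwise bounded, because every vector is of the form \<open>T z\<close>
  and \<open>\<bar>\<langle>T z, y\<rangle>\<bar> = \<bar>\<langle>z, T\<^sup>* y\<rangle>\<bar> \<le> \<parallel>z\<parallel>\<close>. So it is bounded
  in norm, and the lower bound follows by scaling.
\<close>

lemma adjoint_bounded_below:
  assumes "hilbert_space H" "hilbert_space K" "T \<in> bounded_ops H K"
    and onto: "T ` carrier H = carrier K"
  shows "bounded_below K H (adjoint H K T)"
proof -
  interpret H: hilbert_space H by fact
  interpret K: hilbert_space K by fact
  note adj_closed = adjoint_closed[OF assms(1-3)]
  define S where "S = {y \<in> carrier K. hnorm H (adjoint H K T y) \<le> 1}"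
  have "\<exists>b>0. \<forall>y\<in>S. hnorm K y \<le> b"
  proof (rule K.uniform_boundedness)
    fix w assume "w \<in> carrier K"
    then obtain z where z: "z \<in> carrier H" "w = T z"
      using onto by blast
    have "cmod (cinner K w y) \<le> hnorm H z" if y: "y \<in> S" for y
    proof -
      have "y \<in> carrier K" "hnorm H (adjoint H K T y) \<le> 1"
        using y by (auto simp: S_def)
      then have "cmod (cinner K w y) \<le> hnorm H z * hnorm H (adjoint H K T y)"
        using H.Cauchy_Schwarz[OF z(1) adj_closed] cinner_adjoint_right[OF assms(1-3) z(1)]
        by (simp add: z(2))
      also have "\<dots> \<le> hnorm H z"
        using y z(1) mult_left_mono[of _ 1 "hnorm H z"] by (simp add: S_def)
      finally show ?thesis .
    qed
    then show "\<exists>b. \<forall>y\<in>S. cmod (cinner K w y) \<le> b"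
      by blast
  qed (auto simp: S_def)
  then obtain b where b: "b > 0" "\<forall>y\<in>S. hnorm K y \<le> b"
    by blast
  have "1 / b * hnorm K y \<le> hnorm H (adjoint H K T y)" if y: "y \<in> carrier K" for y
  proof -
    let ?a = "hnorm H (adjoint H K T y)"
    have scaled: "t * hnorm K y \<le> b" if t: "t \<ge> 0" "t * ?a \<le> 1" for t
    proof -
      have "of_real t \<odot>\<^bsub>K\<^esub> y \<in> S"
        using t y op_smult[OF adjoint_bounded_op[OF assms(1-3)] y]
        by (simp add: S_def H.hnorm_smult adj_closed)
      then show ?thesis
        using bspec[OF b(2), of "of_real t \<odot>\<^bsub>K\<^esub> y"] t(1) y by (simp add: K.hnorm_smult)
    qed
    show ?thesis
    proof (cases "?a = 0")
      case True
      have "hnorm K y = 0"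
      proof (rule ccontr)
        assume "hnorm K y \<noteq> 0"
        then have "hnorm K y > 0"
          using y by (simp add: less_le)
        then show False
          using scaled[of "(b + 1) / hnorm K y"] True b(1) by simp
      qed
      with True show ?thesis by simp
    next
      case False
      then have "?a > 0"
        using H.hnorm_nonneg[OF adj_closed[OF y]] by (simp add: less_le)
      then show ?thesis
        using scaled[of "1 / ?a"] b(1) by (simp add: field_simps)
    qed
  qed
  then show ?thesis
    unfolding bounded_below_def using b(1) by (intro exI[of _ "1 / b"]) simp
qed

text \<open>
  Surjectivity of \<open>T\<close> bounds \<open>T\<^sup>*\<close> below. Then \<open>T\<^sup>*\<close> has closed range, and this range is everything
  because a vector orthogonal to it lies in the kernel of \<open>T\<close>. So \<open>T\<^sup>*\<close> is onto as well, and the same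
  argument bounds \<open>T = (T\<^sup>*)\<^sup>*\<close> below.
\<close>

lemma isomorphism_bounded_below:
  assumes "hilbert_space H" "hilbert_space K" "isomorphism H K T"
  shows "bounded_below H K T" and "bounded_below K H (adjoint H K T)"
proof -
  interpret H: hilbert_space H by fact
  interpret K: hilbert_space K by fact
  let ?R = "adjoint H K T ` carrier K"
  have T: "T \<in> bounded_ops H K" and bij: "bij_betw T (carrier H) (carrier K)"
    using assms(3) by (auto simp: isomorphism_def)
  note adj = adjoint_bounded_op[OF assms(1,2) T] and closed = op_closed[OF T]
  show below: "bounded_below K H (adjoint H K T)"
    using bij by (intro adjoint_bounded_below assms T) (simp add: bij_betw_def)
  then have R: "hilbert_space (H\<lparr>carrier := ?R\<rparr>)"
    by (intro hilbert_range bounded_below_closed_range assms adj)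
  have R_sub: "?R \<subseteq> carrier H"
    using adj by (auto simp: op_closed)
  have "x \<in> ?R" if x: "x \<in> carrier H" for x
  proof -
    obtain p where p: "p \<in> ?R" "\<forall>m\<in>?R. cinner H m (x \<ominus>\<^bsub>H\<^esub> p) = 0"
      using orthogonal_projection[OF assms(1) R R_sub x] by blast
    then have pH: "p \<in> carrier H"
      using R_sub by blast
    have "T (x \<ominus>\<^bsub>H\<^esub> p) = \<zero>\<^bsub>K\<^esub>"
    proof (rule K.cinner_eqI)
      fix y assume y: "y \<in> carrier K"
      then show "cinner K y (T (x \<ominus>\<^bsub>H\<^esub> p)) = cinner K y \<zero>\<^bsub>K\<^esub>"
        using p(2) x pH cinner_adjoint_left[OF assms(1,2) T _ y, of "x \<ominus>\<^bsub>H\<^esub> p"] by simp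
    qed (use x pH closed in auto)
    then have "x \<ominus>\<^bsub>H\<^esub> p = \<zero>\<^bsub>H\<^esub>"
      using bij inj_on_iff_kernel[OF assms(1,2) T] x pH by (auto simp: bij_betw_def)
    then show ?thesis
      using p(1) x pH by (simp add: H.diff_eq_0)
  qed
  then have "?R = carrier H"
    using R_sub by blast
  then have "bounded_below H K (adjoint K H (adjoint H K T))"
    by (intro adjoint_bounded_below assms adj)
  then show "bounded_below H K T"
    unfolding bounded_below_def by (simp add: adjoint_adjoint[OF assms(1,2) T])
qed

text \<open>
  By Cauchy--Schwarz, since \<open>\<langle>x, T\<^sup>* T x\<rangle> = \<parallel>T x\<parallel>\<^sup>2 \<ge> c\<^sup>2 \<parallel>x\<parallel>\<^sup>2\<close>.
\<close>

lemma bounded_below_adjoint_comp: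
  assumes "hilbert_space H" "hilbert_space K" "T \<in> bounded_ops H K" "bounded_below H K T"
  shows "bounded_below H H (adjoint H K T \<circ> T)"
proof -
  interpret H: hilbert_space H by fact
  interpret K: hilbert_space K by fact
  obtain c where c: "c > 0" "\<forall>x\<in>carrier H. c * hnorm H x \<le> hnorm K (T x)"
    using assms(4) unfolding bounded_below_def by blast
  have "c\<^sup>2 * hnorm H x \<le> hnorm H (adjoint H K T (T x))" if x: "x \<in> carrier H" for x
  proof (cases "hnorm H x = 0")
    case True
    then show ?thesis
      using adjoint_closed[OF assms(1-3)] op_closed[OF assms(3) x] by simp
  next
    case False
    have Tx: "T x \<in> carrier K" and y: "adjoint H K T (T x) \<in> carrier H"
      using op_closed[OF assms(3) x] adjoint_closed[OF assms(1-3)] by auto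
    have "(c * hnorm H x)\<^sup>2 \<le> (hnorm K (T x))\<^sup>2"
      using c x by (intro power_mono) auto
    also have "\<dots> = Re (cinner H x (adjoint H K T (T x)))"
      using cinner_adjoint_right[OF assms(1-3) x Tx] Tx by (simp add: K.hnorm_sq)
    also have "\<dots> \<le> hnorm H x * hnorm H (adjoint H K T (T x))"
      using H.Cauchy_Schwarz[OF x y] complex_Re_le_cmod order_trans by blast
    finally have "hnorm H x * (c\<^sup>2 * hnorm H x) \<le> hnorm H x * hnorm H (adjoint H K T (T x))"
      by (simp add: power2_eq_square ac_simps)
    moreover have "hnorm H x > 0"
      using False x by (simp add: less_le)
    ultimately show ?thesis
      by simp
  qed
  with c(1) show ?thesis
    unfolding bounded_below_def by (intro exI[of _ "c\<^sup>2"]) simp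
qed

section \<open>Kernels of block factorizations\<close>

lemma EP_iff:
  assumes "T \<in> bounded_ops H H" "closed_range H H T"
  shows "EP H T \<longleftrightarrow> (\<forall>x\<in>carrier H. T x = \<zero>\<^bsub>H\<^esub> \<longleftrightarrow> adjoint H H T x = \<zero>\<^bsub>H\<^esub>)"
  using assms by (auto simp: EP_def a_kernel_def' set_eq_iff)

lemma oplus_zero_pair [simp]: "oplus_zero L A (y, z) = (A y, \<zero>\<^bsub>L\<^esub>)"
  by (simp add: oplus_zero_def)

lemma factor_oplus_zero_eq_0:
  assumes "hilbert_space H" "hilbert_space K" "hilbert_space L"
    and V: "V \<in> bounded_ops (hsum K L) H" and A: "A \<in> bounded_ops K K"
    and s: "s \<in> carrier (hsum K L)" and fst: "fst s = \<zero>\<^bsub>K\<^esub>"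
  shows "V (oplus_zero L A s) = \<zero>\<^bsub>H\<^esub>"
  using op_zero[OF hilbert_hsum[OF assms(2,3)] assms(1) V] op_zero[OF assms(2,2) A] fst
  by (cases s) simp

lemma factor_oplus_zero_eq_0_iff:
  assumes "hilbert_space H" "hilbert_space K" "hilbert_space L"
    and V: "V \<in> bounded_ops (hsum K L) H" "inj_on V (carrier (hsum K L))"
    and A: "A \<in> bounded_ops K K" "inj_on A (carrier K)"
    and s: "s \<in> carrier (hsum K L)"
  shows "V (oplus_zero L A s) = \<zero>\<^bsub>H\<^esub> \<longleftrightarrow> fst s = \<zero>\<^bsub>K\<^esub>"
proof
  interpret K: hilbert_space K by fact
  interpret L: hilbert_space L by fact
  obtain y z where yz: "s = (y, z)" "y \<in> carrier K" "z \<in> carrier L"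
    using s by (cases s) simp
  assume "V (oplus_zero L A s) = \<zero>\<^bsub>H\<^esub>"
  moreover have "(A y, \<zero>\<^bsub>L\<^esub>) \<in> carrier (hsum K L)"
    using op_closed[OF A(1) yz(2)] by simp
  ultimately have "(A y, \<zero>\<^bsub>L\<^esub>) = \<zero>\<^bsub>hsum K L\<^esub>"
    using inj_on_iff_kernel[OF hilbert_hsum[OF assms(2,3)] assms(1) V(1)] V(2) yz(1)
    by (metis oplus_zero_pair)
  then show "fst s = \<zero>\<^bsub>K\<^esub>"
    using inj_on_iff_kernel[OF assms(2,2) A(1)] A(2) yz by simp
next
  assume "fst s = \<zero>\<^bsub>K\<^esub>"
  then show "V (oplus_zero L A s) = \<zero>\<^bsub>H\<^esub>"
    by (rule factor_oplus_zero_eq_0[OF assms(1-3) V(1) A(1) s])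
qed

lemma left_injective_form_kernel:
  assumes H: "hilbert_space H" and T: "T \<in> bounded_ops H H"
    and K: "hilbert_space K" and L: "hilbert_space L" and form: "left_injective_form H T K L"
    and x: "x \<in> carrier H" "T x = \<zero>\<^bsub>H\<^esub>"
  shows "adjoint H H T x = \<zero>\<^bsub>H\<^esub>"
proof -
  obtain V W S A B where ops: "V \<in> bounded_ops (hsum K L) H" "W \<in> bounded_ops (hsum K L) H"
      "S \<in> bounded_ops H (hsum K L)" "A \<in> bounded_ops K K" "B \<in> bounded_ops K K"
    and inj: "inj_on V (carrier (hsum K L))" "inj_on A (carrier K)"
    and eq: "\<forall>x\<in>carrier H. adjoint H H T (T x) = V (oplus_zero L A (S x))"
      "\<forall>x\<in>carrier H. T (adjoint H H T x) = W (oplus_zero L B (S x))"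
    using form unfolding left_injective_form_def by blast
  have Sx: "S x \<in> carrier (hsum K L)"
    using ops(3) x(1) by (rule op_closed)
  have "V (oplus_zero L A (S x)) = \<zero>\<^bsub>H\<^esub>"
    using eq(1) x adjoint_comp_eq_0_iff[OF H H T x(1)] by metis
  then have "fst (S x) = \<zero>\<^bsub>K\<^esub>"
    using factor_oplus_zero_eq_0_iff[OF H K L ops(1) inj(1) ops(4) inj(2) Sx] by blast
  then have "T (adjoint H H T x) = \<zero>\<^bsub>H\<^esub>"
    using eq(2) x(1) factor_oplus_zero_eq_0[OF H K L ops(2,5) Sx] by simp
  then show ?thesis
    using comp_adjoint_eq_0_iff[OF H H T x(1)] by blast
qed

lemma right_injective_form_kernel:
  assumes H: "hilbert_space H" and T: "T \<in> bounded_ops H H"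
    and K: "hilbert_space K" and L: "hilbert_space L" and form: "right_injective_form H T K L"
    and x: "x \<in> carrier H" "adjoint H H T x = \<zero>\<^bsub>H\<^esub>"
  shows "T x = \<zero>\<^bsub>H\<^esub>"
proof -
  obtain V W S A B where ops: "V \<in> bounded_ops (hsum K L) H" "W \<in> bounded_ops (hsum K L) H"
      "S \<in> bounded_ops H (hsum K L)" "A \<in> bounded_ops K K" "B \<in> bounded_ops K K"
    and inj: "inj_on W (carrier (hsum K L))" "inj_on B (carrier K)"
    and eq: "\<forall>x\<in>carrier H. adjoint H H T (T x) = V (oplus_zero L A (S x))"
      "\<forall>x\<in>carrier H. T (adjoint H H T x) = W (oplus_zero L B (S x))"
    using form unfolding right_injective_form_def by blast
  have Sx: "S x \<in> carrier (hsum K L)"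
    using ops(3) x(1) by (rule op_closed)
  have "W (oplus_zero L B (S x)) = \<zero>\<^bsub>H\<^esub>"
    using eq(2) x comp_adjoint_eq_0_iff[OF H H T x(1)] by metis
  then have "fst (S x) = \<zero>\<^bsub>K\<^esub>"
    using factor_oplus_zero_eq_0_iff[OF H K L ops(2) inj(1) ops(5) inj(2) Sx] by blast
  then have "adjoint H H T (T x) = \<zero>\<^bsub>H\<^esub>"
    using eq(1) x(1) factor_oplus_zero_eq_0[OF H K L ops(1,4) Sx] by simp
  then show ?thesis
    using adjoint_comp_eq_0_iff[OF H H T x(1)] by blast
qed

lemma similarity_form_kernel:
  assumes H: "hilbert_space H" and T: "T \<in> bounded_ops H H"
    and K: "hilbert_space K" and L: "hilbert_space L" and form: "similarity_form H T K L"
    and x: "x \<in> carrier H"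
  shows "T x = \<zero>\<^bsub>H\<^esub> \<longleftrightarrow> adjoint H H T x = \<zero>\<^bsub>H\<^esub>"
proof -
  let ?S = "inv_into (carrier (hsum K L))"
  obtain U A B where U: "isomorphism (hsum K L) H U"
    and ops: "A \<in> bounded_ops K K" "B \<in> bounded_ops K K"
    and inj: "inj_on A (carrier K)" "inj_on B (carrier K)"
    and eq: "\<forall>x\<in>carrier H. adjoint H H T (T x) = U (oplus_zero L A (?S U x))"
      "\<forall>x\<in>carrier H. T (adjoint H H T x) = U (oplus_zero L B (?S U x))"
    using form unfolding similarity_form_def by blast
  from U have Ub: "U \<in> bounded_ops (hsum K L) H" and bij: "bij_betw U (carrier (hsum K L)) (carrier H)"
    by (simp_all add: isomorphism_def)
  have Uinj: "inj_on U (carrier (hsum K L))"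
    using bij by (rule bij_betw_imp_inj_on)
  have s: "?S U x \<in> carrier (hsum K L)"
    using bij x by (metis bij_betw_imp_surj_on inv_into_into)
  have "T x = \<zero>\<^bsub>H\<^esub> \<longleftrightarrow> fst (?S U x) = \<zero>\<^bsub>K\<^esub>"
    using factor_oplus_zero_eq_0_iff[OF H K L Ub Uinj ops(1) inj(1) s]
      adjoint_comp_eq_0_iff[OF H H T x] bspec[OF eq(1) x] by simp
  moreover have "adjoint H H T x = \<zero>\<^bsub>H\<^esub> \<longleftrightarrow> fst (?S U x) = \<zero>\<^bsub>K\<^esub>"
    using factor_oplus_zero_eq_0_iff[OF H K L Ub Uinj ops(2) inj(2) s]
      comp_adjoint_eq_0_iff[OF H H T x] bspec[OF eq(2) x] by simp
  ultimately show ?thesis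
    by simp
qed

lemma unitary_form_imp_forms:
  assumes H: "hilbert_space H" and K: "hilbert_space K" and L: "hilbert_space L"
    and form: "unitary_form H T K L"
  shows "left_injective_form H T K L \<and> right_injective_form H T K L \<and> similarity_form H T K L"
proof -
  let ?Ua = "adjoint (hsum K L) H"
  obtain U A where U: "unitary (hsum K L) H U" and A: "isomorphism K K A"
    and eq: "\<forall>x\<in>carrier H. adjoint H H T (T x) = U (oplus_zero L (adjoint K K A \<circ> A) (?Ua U x))"
      "\<forall>x\<in>carrier H. T (adjoint H H T x) = U (oplus_zero L (A \<circ> adjoint K K A) (?Ua U x))"
    using form unfolding unitary_form_def by blast
  have KL: "hilbert_space (hsum K L)"
    using K L by (rule hilbert_hsum)
  from U have Ub: "U \<in> bounded_ops (hsum K L) H"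
    and UaU: "\<And>x. x \<in> carrier (hsum K L) \<Longrightarrow> ?Ua U (U x) = x"
    and UUa: "\<And>x. x \<in> carrier H \<Longrightarrow> U (?Ua U x) = x"
    by (auto simp: unitary_def)
  have Uab: "?Ua U \<in> bounded_ops H (hsum K L)"
    by (rule adjoint_bounded_op[OF KL H Ub])
  have Uinj: "inj_on U (carrier (hsum K L))"
    using UaU by (rule inj_on_inverseI)
  have "U ` carrier (hsum K L) = carrier H"
  proof
    show "carrier H \<subseteq> U ` carrier (hsum K L)"
    proof
      fix x assume x: "x \<in> carrier H"
      show "x \<in> U ` carrier (hsum K L)"
        by (rule image_eqI[where x = "?Ua U x"]) (simp_all only: UUa[OF x] op_closed[OF Uab x])
    qed
  qed (use op_closed[OF Ub] in blast)
  with Uinj have Uiso: "isomorphism (hsum K L) H U"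
    using Ub by (simp add: isomorphism_def bij_betw_def)
  have inv: "inv_into (carrier (hsum K L)) U x = ?Ua U x" if x: "x \<in> carrier H" for x
    using inv_into_f_f[OF Uinj op_closed[OF Uab x]] UUa[OF x] by simp
  from A have Ab: "A \<in> bounded_ops K K"
    by (simp add: isomorphism_def)
  have Aab: "adjoint K K A \<in> bounded_ops K K"
    by (rule adjoint_bounded_op[OF K K Ab])
  let ?A = "adjoint K K A \<circ> A" and ?B = "A \<circ> adjoint K K A"
  have ops: "?A \<in> bounded_ops K K" "?B \<in> bounded_ops K K"
    using op_comp[OF K K Ab Aab] op_comp[OF K K Aab Ab] by blast+
  have "bounded_below K K ?A"
    by (intro bounded_below_adjoint_comp K Ab isomorphism_bounded_below A)
  moreover have "bounded_below K K ?B"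
  proof -
    \<comment> \<open>\<open>AA\<^sup>*\<close> is treated as \<open>(A\<^sup>*)\<^sup>*A\<^sup>*\<close>.\<close>
    have "bounded_below K K (adjoint K K (adjoint K K A) \<circ> adjoint K K A)"
      by (intro bounded_below_adjoint_comp K Aab isomorphism_bounded_below A)
    then show ?thesis
      using op_closed[OF Aab] unfolding bounded_below_def by (simp add: adjoint_adjoint[OF K K Ab])
  qed
  ultimately have inj: "inj_on ?A (carrier K)" "inj_on ?B (carrier K)"
    and range: "closed_range K K ?A" "closed_range K K ?B"
    using bounded_below_inj[OF K K] bounded_below_closed_range[OF K K] ops by blast+
  have "left_injective_form H T K L"
    unfolding left_injective_form_def using Ub Uab ops Uinj inj(1) eq by blast
  moreover have "right_injective_form H T K L"
    unfolding right_injective_form_def using Ub Uab ops Uinj inj(2) eq by blast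
  moreover have "similarity_form H T K L"
    unfolding similarity_form_def
    by (intro exI[of _ U] conjI Uiso bexI[of _ ?A] bexI[of _ ?B] inj range ops)
      (use eq inv in simp_all)
  ultimately show ?thesis
    by blast
qed

lemma injective_forms_imp_EP:
  assumes "hilbert_space H" "T \<in> bounded_ops H H" "closed_range H H T"
    and "hilbert_space K" "hilbert_space L" "left_injective_form H T K L"
    and "hilbert_space K'" "hilbert_space L'" "right_injective_form H T K' L'"
  shows "EP H T"
  using left_injective_form_kernel[OF assms(1,2,4-6)] right_injective_form_kernel[OF assms(1,2,7-9)]
  by (auto simp: EP_iff[OF assms(2,3)])

lemma similarity_form_imp_EP:
  assumes "hilbert_space H" "T \<in> bounded_ops H H" "closed_range H H T"
    and "hilbert_space K" "hilbert_space L" "similarity_form H T K L"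
  shows "EP H T"
  using similarity_form_kernel[OF assms(1,2,4-6)] by (simp add: EP_iff[OF assms(2,3)])

lemma unitary_form_imp_EP:
  assumes "hilbert_space H" "T \<in> bounded_ops H H" "closed_range H H T"
    and "hilbert_space K" "hilbert_space L" "unitary_form H T K L"
  shows "EP H T"
  using similarity_form_imp_EP[OF assms(1-5)] unitary_form_imp_forms[OF assms(1,4-6)] by blast
section \<open>The block decomposition of an EP operator\<close>

lemma EP_imp_unitary_form:
  assumes H: "hilbert_space H" and T: "T \<in> bounded_ops H H" and range: "closed_range H H T"
    and EP: "EP H T"
  defines "K \<equiv> H\<lparr>carrier := T ` carrier H\<rparr>"
    and "L \<equiv> H\<lparr>carrier := {x \<in> carrier H. T x = \<zero>\<^bsub>H\<^esub>}\<rparr>"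
  shows "hilbert_space K \<and> hilbert_space L \<and> unitary_form H T K L"
proof -
  interpret H: hilbert_space H by fact
  let ?T' = "adjoint H H T" and ?R = "T ` carrier H"
  note closed = op_closed[OF T]
  note closed' = adjoint_closed[OF H H T]
  note adj_right = cinner_adjoint_right[OF H H T] and adj_left = cinner_adjoint_left[OF H H T]
  have ker: "T x = \<zero>\<^bsub>H\<^esub> \<longleftrightarrow> ?T' x = \<zero>\<^bsub>H\<^esub>" if "x \<in> carrier H" for x
    using EP that by (simp add: EP_iff[OF T range])
  have K: "hilbert_space K"
    unfolding K_def by (rule hilbert_range[OF H H T range])
  have L: "hilbert_space L"
    unfolding L_def by (rule hilbert_kernel[OF H H T])
  interpret K: hilbert_space K by fact
  have KL: "hilbert_space (hsum K L)"
    using K L by (rule hilbert_hsum)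
  have K_simps [simp]: "carrier K = ?R" "add K = add H" "smult K = smult H" "cinner K = cinner H"
      "zero K = zero H" "hnorm K = hnorm H"
    by (simp_all add: K_def hnorm_def fun_eq_iff)
  have L_simps [simp]: "carrier L = {x \<in> carrier H. T x = \<zero>\<^bsub>H\<^esub>}" "add L = add H"
      "smult L = smult H" "cinner L = cinner H" "zero L = zero H"
    by (simp_all add: L_def)
  have R_sub: "y \<in> carrier H" if "y \<in> ?R" for y
    using that closed by blast
  have orth: "cinner H y z = 0" if "y \<in> ?R" "z \<in> carrier H" "T z = \<zero>\<^bsub>H\<^esub>" for y z
    using that ker[of z] adj_right[of _ z] by force
  have orth': "cinner H z y = 0" if "y \<in> ?R" "z \<in> carrier H" "T z = \<zero>\<^bsub>H\<^esub>" for y z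
    using orth[OF that] H.cinner_commute[of y z] R_sub that by simp
  have "\<exists>p\<in>?R. T (x \<ominus>\<^bsub>H\<^esub> p) = \<zero>\<^bsub>H\<^esub>" if x: "x \<in> carrier H" for x
  proof -
    obtain p where p: "p \<in> ?R" "\<forall>m\<in>?R. cinner H m (x \<ominus>\<^bsub>H\<^esub> p) = 0"
      using orthogonal_projection[OF H K[unfolded K_def] _ x] R_sub by blast
    have d: "x \<ominus>\<^bsub>H\<^esub> p \<in> carrier H"
      using x R_sub[OF p(1)] by simp
    have "?T' (x \<ominus>\<^bsub>H\<^esub> p) = \<zero>\<^bsub>H\<^esub>"
      using p(2) d by (intro H.cinner_eqI) (simp_all add: closed' adj_right)
    with p(1) ker[OF d] show ?thesis
      by blast
  qed
  \<comment> \<open>\<open>P\<close> is the orthogonal projection onto the range of \<open>T\<close>, and \<open>x - P x\<close> lies in the kernel of \<open>T\<close>.\<close>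
  then obtain P where PR: "\<And>x. x \<in> carrier H \<Longrightarrow> P x \<in> ?R"
    and PN: "\<And>x. x \<in> carrier H \<Longrightarrow> T (x \<ominus>\<^bsub>H\<^esub> P x) = \<zero>\<^bsub>H\<^esub>"
    by metis
  have PH: "P x \<in> carrier H" if "x \<in> carrier H" for x
    using PR[OF that] by (rule R_sub)
  have decomp: "P x \<oplus>\<^bsub>H\<^esub> (x \<ominus>\<^bsub>H\<^esub> P x) = x" if "x \<in> carrier H" for x
    using that PH by (intro H.cinner_eqI) (simp_all add: H.cinner_simps)
  have TP: "T (P x) = T x" if x: "x \<in> carrier H" for x
  proof -
    have "T x \<ominus>\<^bsub>H\<^esub> T (P x) = \<zero>\<^bsub>H\<^esub>"
      using PN[OF x] op_diff[OF H H T x PH[OF x]] by simp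
    then show ?thesis
      using x PH closed by (simp add: H.diff_eq_0)
  qed
  have T'P: "?T' (P x) = ?T' x" if x: "x \<in> carrier H" for x
  proof -
    have "?T' (x \<ominus>\<^bsub>H\<^esub> P x) = \<zero>\<^bsub>H\<^esub>"
      using PN[OF x] ker[of "x \<ominus>\<^bsub>H\<^esub> P x"] x PH by simp
    then have "?T' x \<ominus>\<^bsub>H\<^esub> ?T' (P x) = \<zero>\<^bsub>H\<^esub>"
      using op_diff[OF H H adjoint_bounded_op[OF H H T] x PH[OF x]] by simp
    then show ?thesis
      using x PH closed' by (simp add: H.diff_eq_0)
  qed

  define U where "U = (\<lambda>(y, z). y \<oplus>\<^bsub>H\<^esub> z)"
  have U_pair: "U (y, z) = y \<oplus>\<^bsub>H\<^esub> z" for y z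
    by (simp add: U_def)
  have Ub: "U \<in> bounded_ops (hsum K L) H"
  proof (rule bounded_opsI[where b = 1])
    fix v w assume "v \<in> carrier (hsum K L)" "w \<in> carrier (hsum K L)"
    then show "U (v \<oplus>\<^bsub>hsum K L\<^esub> w) = U v \<oplus>\<^bsub>H\<^esub> U w"
      using R_sub unfolding U_def by (cases v; cases w) (simp add: H.M.add.m_ac)
  next
    fix v assume "v \<in> carrier (hsum K L)"
    then obtain y z where v: "v = (y, z)" "y \<in> ?R" "z \<in> carrier H" "T z = \<zero>\<^bsub>H\<^esub>"
      by (cases v) simp
    then show "hnorm H (U v) \<le> 1 * hnorm (hsum K L) v"
      using R_sub[OF v(2)] orth[OF v(2-4)] orth'[OF v(2-4)]
      by (simp add: U_def hnorm_def H.cinner_simps)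
  qed (use R_sub in \<open>auto simp: U_def H.smult_r_distr\<close>)
  have adjU: "adjoint (hsum K L) H U x = (P x, x \<ominus>\<^bsub>H\<^esub> P x)" if x: "x \<in> carrier H" for x
  proof (rule adjoint_eqI[OF KL])
    show "(P x, x \<ominus>\<^bsub>H\<^esub> P x) \<in> carrier (hsum K L)"
      using PR PN PH x by simp
    fix v assume "v \<in> carrier (hsum K L)"
    then obtain y z where v: "v = (y, z)" "y \<in> ?R" "z \<in> carrier H" "T z = \<zero>\<^bsub>H\<^esub>"
      by (cases v) simp
    have "cinner H (U v) x = cinner H (U v) (P x \<oplus>\<^bsub>H\<^esub> (x \<ominus>\<^bsub>H\<^esub> P x))"
      by (simp add: decomp x)
    also have "\<dots> = cinner H y (P x) + cinner H z (x \<ominus>\<^bsub>H\<^esub> P x)"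
      using v R_sub[OF v(2)] x PH orth[OF v(2) _ PN[OF x]] orth'[OF PR[OF x] v(3,4)]
      by (simp add: U_def H.cinner_add_left H.cinner_add_right)
    finally show "cinner H (U v) x = cinner (hsum K L) v (P x, x \<ominus>\<^bsub>H\<^esub> P x)"
      by (simp add: v(1))
  qed
  have "unitary (hsum K L) H U"
    unfolding unitary_def
  proof (intro conjI ballI Ub)
    fix v assume v': "v \<in> carrier (hsum K L)"
    then obtain y z where v: "v = (y, z)" "y \<in> ?R" "z \<in> carrier H" "T z = \<zero>\<^bsub>H\<^esub>"
      by (cases v) simp
    show "adjoint (hsum K L) H U (U v) = v"
    proof (rule adjoint_eqI[OF KL v'])
      fix w assume "w \<in> carrier (hsum K L)"
      then obtain y' z' where w: "w = (y', z')" "y' \<in> ?R" "z' \<in> carrier H" "T z' = \<zero>\<^bsub>H\<^esub>"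
        by (cases w) simp
      show "cinner H (U w) (U v) = cinner (hsum K L) w v"
        using R_sub v w orth[OF w(2) v(3,4)] orth'[OF v(2) w(3,4)]
        by (simp add: U_def H.cinner_add_left H.cinner_add_right)
    qed
  next
    fix x assume x: "x \<in> carrier H"
    show "U (adjoint (hsum K L) H U x) = x"
      unfolding adjU[OF x] by (simp add: U_def decomp x)
  qed
  moreover have T_K: "T \<in> bounded_ops K K"
  proof -
    obtain b where "\<forall>x\<in>carrier H. hnorm H (T x) \<le> b * hnorm H x"
      using op_bound[OF H T] by blast
    then show ?thesis
      using R_sub op_add[OF T] op_smult[OF T] by (intro bounded_opsI[where b = b]) auto
  qed
  have "isomorphism K K T"
    unfolding isomorphism_def bij_betw_def
  proof (intro conjI T_K)
    have "y = \<zero>\<^bsub>H\<^esub>" if y: "y \<in> ?R" "T y = \<zero>\<^bsub>H\<^esub>" for y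
      using orth[OF y(1) R_sub[OF y(1)] y(2)] H.cinner_self_eq_0[OF R_sub[OF y(1)]] by simp
    then show "inj_on T (carrier K)"
      using inj_on_iff_kernel[OF K K T_K] by simp
    show "T ` carrier K = carrier K"
    proof
      show "carrier K \<subseteq> T ` carrier K"
      proof
        fix y assume "y \<in> carrier K"
        then obtain x where "x \<in> carrier H" "y = T (P x)"
          using TP by auto
        then show "y \<in> T ` carrier K"
          using PR by simp
      qed
    qed (use R_sub in auto)
  qed
  moreover have adjK: "adjoint K K T y = ?T' y" if y: "y \<in> ?R" for y
  proof (rule adjoint_eqI[OF K])
    have yH: "y \<in> carrier H"
      using y by (rule R_sub)
    let ?x = "?T' y"
    have x: "?x \<in> carrier H"
      using yH by (rule closed')
    let ?n = "?x \<ominus>\<^bsub>H\<^esub> P ?x"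
    have n: "?n \<in> carrier H" "T ?n = \<zero>\<^bsub>H\<^esub>"
      using x PH PN by auto
    \<comment> \<open>The kernel component of \<open>T\<^sup>* y\<close> vanishes, so \<open>T\<^sup>* y\<close> lies in the range of \<open>T\<close>.\<close>
    have "cinner H ?n ?n = cinner H ?n ?x - cinner H ?n (P ?x)"
      using n(1) x PH by (simp add: a_minus_def[of H ?x] H.cinner_add_right H.cinner_minus_right)
    also have "\<dots> = 0"
      using orth'[OF PR[OF x] n] adj_right[OF n(1) yH] n(2) yH by simp
    finally have "?n = \<zero>\<^bsub>H\<^esub>"
      using H.cinner_self_eq_0[OF n(1)] by blast
    then have "?x = P ?x"
      using x PH by (simp add: H.diff_eq_0)
    then show "?x \<in> carrier K"
      using PR[OF x] by simp
    show "cinner K (T z) y = cinner K z ?x" if "z \<in> carrier K" for z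
      using adj_right[OF R_sub yH] that by simp
  qed
  moreover have "\<forall>x\<in>carrier H. ?T' (T x) =
      U (oplus_zero L (adjoint K K T \<circ> T) (adjoint (hsum K L) H U x))"
    using PH by (simp add: adjU U_pair adjK TP closed closed')
  moreover have "\<forall>x\<in>carrier H. T (?T' x) =
      U (oplus_zero L (T \<circ> adjoint K K T) (adjoint (hsum K L) H U x))"
    using PR by (simp add: adjU U_pair adjK T'P closed closed')
  ultimately have "unitary_form H T K L"
    unfolding unitary_form_def by blast
  with K L show ?thesis
    by blast
qed

section \<open>The equivalences\<close>

(* HOL cannot quantify over types inside a formula. The equivalences are stated with witnesses
   whose carriers are sets of elements of 'h; the last three conjuncts add that witnesses over
   arbitrary other types also force T to be EP. *)
theorem proposition3p10:
  fixes H :: "'h hilbert" and T :: "'h \<Rightarrow> 'h"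
  assumes "hilbert_space H"
    and "T \<in> bounded_ops H H"
    and "closed_range H H T"
  shows
    "(EP H T \<longleftrightarrow>
       (\<exists>(K\<^sub>1 :: 'h hilbert) (L\<^sub>1 :: 'h hilbert).
          hilbert_space K\<^sub>1 \<and> hilbert_space L\<^sub>1 \<and> unitary_form H T K\<^sub>1 L\<^sub>1)) \<and>
     (EP H T \<longleftrightarrow>
       (\<exists>(K\<^sub>2 :: 'h hilbert) (L\<^sub>2 :: 'h hilbert).
          hilbert_space K\<^sub>2 \<and> hilbert_space L\<^sub>2 \<and> left_injective_form H T K\<^sub>2 L\<^sub>2) \<and>
       (\<exists>(K\<^sub>3 :: 'h hilbert) (L\<^sub>3 :: 'h hilbert).
          hilbert_space K\<^sub>3 \<and> hilbert_space L\<^sub>3 \<and> right_injective_form H T K\<^sub>3 L\<^sub>3)) \<and>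
     (EP H T \<longleftrightarrow>
       (\<exists>(K\<^sub>4 :: 'h hilbert) (L\<^sub>4 :: 'h hilbert).
          hilbert_space K\<^sub>4 \<and> hilbert_space L\<^sub>4 \<and> similarity_form H T K\<^sub>4 L\<^sub>4)) \<and>
     ((\<exists>(K\<^sub>1 :: 'k1 hilbert) (L\<^sub>1 :: 'l1 hilbert).
          hilbert_space K\<^sub>1 \<and> hilbert_space L\<^sub>1 \<and> unitary_form H T K\<^sub>1 L\<^sub>1) \<longrightarrow> EP H T) \<and>
     ((\<exists>(K\<^sub>2 :: 'k2 hilbert) (L\<^sub>2 :: 'l2 hilbert).
          hilbert_space K\<^sub>2 \<and> hilbert_space L\<^sub>2 \<and> left_injective_form H T K\<^sub>2 L\<^sub>2) \<and>
      (\<exists>(K\<^sub>3 :: 'k3 hilbert) (L\<^sub>3 :: 'l3 hilbert).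
          hilbert_space K\<^sub>3 \<and> hilbert_space L\<^sub>3 \<and> right_injective_form H T K\<^sub>3 L\<^sub>3) \<longrightarrow> EP H T) \<and>
     ((\<exists>(K\<^sub>4 :: 'k4 hilbert) (L\<^sub>4 :: 'l4 hilbert).
          hilbert_space K\<^sub>4 \<and> hilbert_space L\<^sub>4 \<and> similarity_form H T K\<^sub>4 L\<^sub>4) \<longrightarrow> EP H T)"
proof -
  note unitary = unitary_form_imp_EP[OF assms]
    and injective = injective_forms_imp_EP[OF assms]
    and similarity = similarity_form_imp_EP[OF assms]
  have forms: "\<exists>(K :: 'h hilbert) (L :: 'h hilbert). hilbert_space K \<and> hilbert_space L \<and>
      unitary_form H T K L \<and> left_injective_form H T K L \<and> right_injective_form H T K L \<and>
      similarity_form H T K L" if "EP H T"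
    using EP_imp_unitary_form[OF assms that] unitary_form_imp_forms[OF assms(1)] by blast
  show ?thesis
    by (intro conjI iffI impI; (elim exE conjE)?)
      (use forms in \<open>blast intro: unitary injective similarity\<close>)+
qed

end
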